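(* If $\mathcal{F}, \mathcal{G} \subseteq \mathcal{M}_{2n}$ are cross-intersecting, then $|\mathcal{F}| \cdot |\mathcal{G}| \leq ((2n-3)!!)^2$.
   Context: $\mathcal{M}_{2n}$ is the set of perfect matchings of the complete graph $K_{2n}$. Two families $\mathcal{F}, \mathcal{G} \subseteq \mathcal{M}_{2n}$ are cross-intersecting if $m \cap m' \neq \emptyset$ (they share an edge) for all $m \in \mathcal{F}$ and $m' \in \mathcal{G}$. $(2n-3)!! = 1 \cdot 3 \cdots (2n-3)$. *)

theory Defs
  imports "HOL-Library.Ramsey"
begin

text \<open>A simple graph is given by a vertex set and a set of two-element vertex sets (its edges).
  The complete graph on \<open>V\<close> has edge set \<open>nsets V 2\<close>, and a matching is the set of its edges.\<close>

definition perfect_matching :: "'a set \<Rightarrow> 'a set set \<Rightarrow> 'a set set \<Rightarrow> bool" where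
  "perfect_matching V E m \<longleftrightarrow> m \<subseteq> E \<and> (\<forall>v\<in>V. \<exists>!e. e \<in> m \<and> v \<in> e)"

definition perfect_matchings_K :: "nat \<Rightarrow> nat set set set" where
  "perfect_matchings_K k = {m. perfect_matching {1..k} (nsets {1..k} 2) m}"

definition cross_intersecting :: "'a set set \<Rightarrow> 'a set set \<Rightarrow> bool" where
  "cross_intersecting F G \<longleftrightarrow> (\<forall>m\<in>F. \<forall>m'\<in>G. m \<inter> m' \<noteq> {})"

text \<open>Since \<open>double_fact 0 = 1\<close>, truncated subtraction gives \<open>double_fact (2 * n - 3) = 1\<close>
  for \<open>n = 1\<close>, in accordance with the convention \<open>(-1)!! = 1\<close> (empty product).\<close>

fun double_fact :: "nat \<Rightarrow> nat" where
  "double_fact 0 = 1"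
| "double_fact (Suc 0) = 1"
| "double_fact (Suc (Suc n)) = Suc (Suc n) * double_fact n"

end

theory Submission
  imports Defs "HOL-Analysis.L2_Norm" "HOL-Combinatorics.Permutations"
begin

text \<open>The bound is a ratio bound. Take the doubly stochastic matrix \<open>A\<close> that sends a matching to a
  uniformly random one forming a Hamiltonian cycle with it. It vanishes on pairs of
  matchings with a common edge, so it suffices that \<open>A\<close> has norm at most \<open>1 / (2n - 2)\<close> on functions
  with sum zero. Fix a vertex \<open>v\<close> and split the matchings into blocks according to the partner of
  \<open>v\<close>. Contracting the path of length two through \<open>v\<close> in the Hamiltonian cycle writes \<open>(2n - 2) A\<close> as
  a block diagonal matrix of smaller copies of \<open>A\<close> composed with the switch operator \<open>T\<close> at \<open>v\<close>.
  On functions constant on the blocks, of sum zero, \<open>T\<close> is \<open>-1\<close> and the block matrix is the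
  identity. On functions of sum zero on every block, the block matrix has norm at most
  \<open>1 / (2n - 4)\<close> by induction, and \<open>T\<close> has norm at most \<open>2n - 4\<close>. The last
  fact is again proved by induction, since a switch changes only two edges and hence can be viewed
  inside the matchings containing any fixed untouched edge.\<close>

lemma double_fact_pos: "0 < double_fact m"
  by (induction m rule: double_fact.induct) auto

section \<open>Fixed-point-free involutions and switches\<close>

text \<open>A perfect matching of \<open>V\<close> is encoded as the map exchanging the two ends of each of its edges
  and fixing everything outside \<open>V\<close>.\<close>

definition fpf_invs :: "'a set \<Rightarrow> ('a \<Rightarrow> 'a) set" where
  "fpf_invs V = {p. (\<forall>x. p (p x) = x) \<and> (\<forall>x. p x = x \<longleftrightarrow> x \<notin> V)}"

lemma fpf_invs_invol: "p \<in> fpf_invs V \<Longrightarrow> p (p x) = x"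
  by (simp add: fpf_invs_def)

lemma fpf_invs_fixed_iff: "p \<in> fpf_invs V \<Longrightarrow> p x = x \<longleftrightarrow> x \<notin> V"
  by (simp add: fpf_invs_def)

lemma fpf_invs_mem_iff: "p \<in> fpf_invs V \<Longrightarrow> p x \<in> V \<longleftrightarrow> x \<in> V"
  by (metis fpf_invs_fixed_iff fpf_invs_invol)

lemma fpf_invs_eq_iff: "p \<in> fpf_invs V \<Longrightarrow> p x = p y \<longleftrightarrow> x = y"
  by (metis fpf_invs_invol)

lemma fpf_invs_permutes: "p \<in> fpf_invs V \<Longrightarrow> p permutes V"
  unfolding permutes_def by (metis fpf_invs_fixed_iff fpf_invs_invol)

lemma finite_fpf_invs [simp]: "finite V \<Longrightarrow> finite (fpf_invs V)"
  by (rule finite_subset[OF _ finite_permutations[of V]]) (auto dest: fpf_invs_permutes)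

lemma fpf_invs_empty [simp]: "fpf_invs {} = {id}"
  by (auto simp: fpf_invs_def fun_eq_iff)

text \<open>Precomposing with the transposition of the ends of an edge makes both ends fixed points
  and so deletes the edge; the same operation restores it. This identifies the matchings through an
  edge with those of the remaining vertices.\<close>

lemma remove_edge_mem:
  assumes "p \<in> fpf_invs V" "p x = y"
  shows "p \<circ> transpose x y \<in> fpf_invs (V - {x, y})"
  using assms unfolding fpf_invs_def transpose_def by auto metis+

lemma add_edge_mem:
  assumes "q \<in> fpf_invs (V - {x, y})" "x \<in> V" "y \<in> V" "x \<noteq> y"
  shows "q \<circ> transpose x y \<in> fpf_invs V" and "(q \<circ> transpose x y) x = y"
  using assms unfolding fpf_invs_def transpose_def by auto

lemma sum_fpf_invs_edge:
  fixes h :: "('a \<Rightarrow> 'a) \<Rightarrow> 'b::comm_monoid_add"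
  assumes "x \<in> V" "y \<in> V" "x \<noteq> y"
  shows "(\<Sum>p | p \<in> fpf_invs V \<and> p x = y. h p) = (\<Sum>q\<in>fpf_invs (V - {x, y}). h (q \<circ> transpose x y))"
  by (rule sum.reindex_bij_witness[where i = "\<lambda>q. q \<circ> transpose x y" and j = "\<lambda>q. q \<circ> transpose x y"])
    (use assms in \<open>auto simp: remove_edge_mem add_edge_mem o_assoc[symmetric] simp del: o_apply\<close>)

lemma sum_fpf_invs_partner:
  fixes h :: "('a \<Rightarrow> 'a) \<Rightarrow> 'b::comm_monoid_add"
  assumes "finite V" "x \<in> V"
  shows "(\<Sum>p\<in>fpf_invs V. h p) = (\<Sum>y\<in>V - {x}. \<Sum>p | p \<in> fpf_invs V \<and> p x = y. h p)"
  by (rule sum.group[symmetric])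
    (use assms in \<open>auto simp: fpf_invs_mem_iff fpf_invs_fixed_iff\<close>)

lemma card_fpf_invs_edge:
  assumes "x \<in> V" "y \<in> V" "x \<noteq> y"
  shows "card {p \<in> fpf_invs V. p x = y} = card (fpf_invs (V - {x, y}))"
  using sum_fpf_invs_edge[OF assms, of "\<lambda>_. 1::nat"] by simp

lemma card_fpf_invs_double_fact:
  assumes "finite V" "card V = 2 * n"
  shows "card (fpf_invs V) = double_fact (2 * n - 1)"
  using assms
proof (induction n arbitrary: V)
  case 0
  then show ?case by simp
next
  case (Suc n)
  then obtain x where x: "x \<in> V" by fastforce
  have "card {p \<in> fpf_invs V. p x = y} = double_fact (2 * n - 1)" if "y \<in> V - {x}" for y
  proof -
    have "card (V - {x, y}) = 2 * n"
      using Suc.prems x that by (subst card_Diff_subset) auto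
    then have "card (fpf_invs (V - {x, y})) = double_fact (2 * n - 1)"
      using Suc.prems by (intro Suc.IH) auto
    then show ?thesis using card_fpf_invs_edge[of x V y] x that by auto
  qed
  then have "card (fpf_invs V) = (\<Sum>y\<in>V - {x}. double_fact (2 * n - 1))"
    using sum_fpf_invs_partner[OF Suc.prems(1) x, of "\<lambda>_. 1::nat"] by simp
  \<comment> \<open>For \<open>n = 0\<close> the truncated \<open>2 * n - 1\<close> is
    \<open>0\<close>, so the recursion of \<open>double_fact\<close> does not apply; hence the case
    split.\<close>
  also have "\<dots> = double_fact (2 * Suc n - 1)"
    using Suc.prems x by (cases n) auto
  finally show ?case .
qed

text \<open>Writing a switch of two edges as a conjugation makes the result an involution for free,
  and the same transposition undoes it.\<close>

definition swap_conj :: "'a \<Rightarrow> 'a \<Rightarrow> ('a \<Rightarrow> 'a) \<Rightarrow> 'a \<Rightarrow> 'a" where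
  "swap_conj u w p = transpose u w \<circ> p \<circ> transpose u w"

lemma swap_conj_mem:
  assumes "p \<in> fpf_invs V" "u \<in> V" "w \<in> V"
  shows "swap_conj u w p \<in> fpf_invs V"
proof -
  have "transpose u w (p (transpose u w x)) = x \<longleftrightarrow> x \<notin> V" for x
  proof -
    have "transpose u w (p (transpose u w x)) = x \<longleftrightarrow> p (transpose u w x) = transpose u w x"
      by (metis transpose_involutory)
    also have "\<dots> \<longleftrightarrow> transpose u w x \<notin> V"
      using assms by (simp add: fpf_invs_fixed_iff)
    also have "\<dots> \<longleftrightarrow> x \<notin> V"
      using assms by (auto simp: transpose_def)
    finally show ?thesis .
  qed
  then show ?thesis
    using assms by (simp add: fpf_invs_def swap_conj_def)
qed

lemma swap_conj_swap_conj [simp]: "swap_conj w u (swap_conj u w p) = p"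
  by (auto simp: swap_conj_def fun_eq_iff transpose_commute[of w u])

lemma swap_conj_partner:
  assumes "p \<in> fpf_invs V" "v \<in> V" "w \<noteq> v"
  shows "swap_conj (p v) w p v = w"
proof -
  have "p v \<noteq> v" using assms by (simp add: fpf_invs_fixed_iff)
  then show ?thesis using assms by (simp add: swap_conj_def)
qed

text \<open>The terms of the sum range over the matchings obtained by replacing the edge at \<open>v\<close>
  and an edge \<open>{w, p w}\<close> by \<open>{v, w}\<close> and \<open>{p v, p w}\<close>.\<close>

definition switch_sum :: "'a set \<Rightarrow> 'a \<Rightarrow> (('a \<Rightarrow> 'a) \<Rightarrow> real) \<Rightarrow> ('a \<Rightarrow> 'a) \<Rightarrow> real" where
  "switch_sum V v f p = (\<Sum>w\<in>V - {v, p v}. f (swap_conj (p v) w p))"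

text \<open>A switch to the partner \<open>u\<close> is invertible once the old partner
  \<open>w = q v\<close> is recorded, so each \<open>q\<close> outside the block of \<open>u\<close>
  comes from exactly one pair \<open>(r, w)\<close> with \<open>r\<close> in that block.\<close>

lemma sum_switch:
  fixes h :: "('a \<Rightarrow> 'a) \<Rightarrow> ('a \<Rightarrow> 'a) \<Rightarrow> 'b::comm_monoid_add"
  assumes "finite V" "v \<in> V" "u \<in> V" "u \<noteq> v"
  shows "(\<Sum>q | q \<in> fpf_invs V \<and> q v \<noteq> u. h q (swap_conj (q v) u q))
    = (\<Sum>r | r \<in> fpf_invs V \<and> r v = u. \<Sum>w\<in>V - {v, u}. h (swap_conj u w r) r)"
proof -
  have "(\<Sum>r | r \<in> fpf_invs V \<and> r v = u. \<Sum>w\<in>V - {v, u}. h (swap_conj u w r) r)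
    = (\<Sum>(r, w)\<in>{r \<in> fpf_invs V. r v = u} \<times> (V - {v, u}). h (swap_conj u w r) r)"
    by (rule sum.cartesian_product)
  also have "\<dots> = (\<Sum>q | q \<in> fpf_invs V \<and> q v \<noteq> u. h q (swap_conj (q v) u q))"
    by (rule sum.reindex_bij_witness[where j = "\<lambda>(r, w). swap_conj u w r" and i = "\<lambda>q. (swap_conj (q v) u q, q v)"])
      (use assms in \<open>auto simp: swap_conj_mem swap_conj_partner fpf_invs_mem_iff fpf_invs_fixed_iff\<close>)
  finally show ?thesis by simp
qed

text \<open>A switch is reversed by switching back to the old partner, so \<open>(p, w)\<close> and
  \<open>(swap_conj (p v) w p, p v)\<close> are exchanged by an involution: the switch operator is
  self-adjoint.\<close>

lemma switch_sum_sym: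
  assumes "finite V" "v \<in> V"
  shows "(\<Sum>p\<in>fpf_invs V. g p * switch_sum V v f p) = (\<Sum>p\<in>fpf_invs V. switch_sum V v g p * f p)"
proof -
  have "(\<Sum>p\<in>fpf_invs V. g p * switch_sum V v f p)
    = (\<Sum>(p, w)\<in>(SIGMA p:fpf_invs V. V - {v, p v}). g p * f (swap_conj (p v) w p))"
    unfolding switch_sum_def sum_distrib_left by (subst sum.Sigma) (use assms in auto)
  also have "\<dots> = (\<Sum>(p, w)\<in>(SIGMA p:fpf_invs V. V - {v, p v}). g (swap_conj (p v) w p) * f p)"
    by (rule sum.reindex_bij_witness[where i = "\<lambda>(p, w). (swap_conj (p v) w p, p v)" and j = "\<lambda>(p, w). (swap_conj (p v) w p, p v)"])
      (use assms in \<open>auto simp: swap_conj_mem swap_conj_partner fpf_invs_mem_iff fpf_invs_fixed_iff\<close>)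
  also have "\<dots> = (\<Sum>p\<in>fpf_invs V. switch_sum V v g p * f p)"
    unfolding switch_sum_def sum_distrib_right by (subst sum.Sigma) (use assms in auto)
  finally show ?thesis .
qed

lemma swap_conj_eqs:
  assumes "p \<in> fpf_invs V" "v \<in> V" "w \<in> V - {v, p v}"
  shows "swap_conj (p v) w p v = w" "swap_conj (p v) w p w = v"
    "swap_conj (p v) w p (p v) = p w" "swap_conj (p v) w p (p w) = p v"
    "x \<notin> {v, w, p v, p w} \<Longrightarrow> swap_conj (p v) w p x = p x"
proof -
  have "p v \<noteq> v" "p w \<noteq> w" "p v \<noteq> p w" "p (p v) = v" "p (p w) = w" "p w \<noteq> v"
    using assms by (auto simp: fpf_invs_fixed_iff fpf_invs_eq_iff fpf_invs_invol)
  then show "swap_conj (p v) w p v = w" "swap_conj (p v) w p w = v"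
    "swap_conj (p v) w p (p v) = p w" "swap_conj (p v) w p (p w) = p v"
    using assms by (auto simp: swap_conj_def)
  assume x: "x \<notin> {v, w, p v, p w}"
  then have "p x \<noteq> p v" "p x \<noteq> w"
    using assms by (auto simp: fpf_invs_eq_iff fpf_invs_invol)
  with x show "swap_conj (p v) w p x = p x"
    by (simp add: swap_conj_def)
qed

section \<open>Spectrum of the switch operator\<close>

definition edge_sum :: "'a set \<Rightarrow> (('a \<Rightarrow> 'a) \<Rightarrow> real) \<Rightarrow> 'a \<Rightarrow> 'a \<Rightarrow> real" where
  "edge_sum V f x y = (\<Sum>p | p \<in> fpf_invs V \<and> p x = y. f p)"

text \<open>This is the adjoint of \<open>edge_sum\<close> over ordered pairs of distinct vertices;
  every edge is met from both ends, whence the factors 2 below.\<close>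

definition edge_lift :: "'a set \<Rightarrow> ('a \<Rightarrow> 'a \<Rightarrow> real) \<Rightarrow> ('a \<Rightarrow> 'a) \<Rightarrow> real" where
  "edge_lift V F p = (\<Sum>x\<in>V. F x (p x))"

text \<open>These are the properties that \<open>edge_sum V f\<close> inherits from a function
  \<open>f\<close> of sum zero, since each of its rows adds up to the total of
  \<open>f\<close>.\<close>

definition balanced_weight :: "'a set \<Rightarrow> ('a \<Rightarrow> 'a \<Rightarrow> real) \<Rightarrow> bool" where
  "balanced_weight V F \<longleftrightarrow> (\<forall>x y. F x y = F y x) \<and> (\<forall>x\<in>V. (\<Sum>y\<in>V - {x}. F x y) = 0)"

lemma balanced_weight_commute: "balanced_weight V F \<Longrightarrow> F x y = F y x"
  by (simp add: balanced_weight_def)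

lemma balanced_weight_row: "balanced_weight V F \<Longrightarrow> x \<in> V \<Longrightarrow> (\<Sum>y\<in>V - {x}. F x y) = 0"
  unfolding balanced_weight_def by (elim conjE) (erule (1) bspec)

lemma edge_sum_commute: "edge_sum V f x y = edge_sum V f y x"
  unfolding edge_sum_def by (rule sum.cong) (auto simp: fpf_invs_invol)

lemma sum_edge_sum:
  assumes "finite V" "x \<in> V"
  shows "(\<Sum>y\<in>V - {x}. edge_sum V f x y) = (\<Sum>p\<in>fpf_invs V. f p)"
  unfolding edge_sum_def by (rule sum_fpf_invs_partner[OF assms, symmetric])

lemma balanced_weight_edge_sum:
  assumes "finite V" "(\<Sum>p\<in>fpf_invs V. f p) = 0"
  shows "balanced_weight V (edge_sum V f)"
  using assms by (auto simp: balanced_weight_def sum_edge_sum intro: edge_sum_commute)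

lemma sum_partner_weight:
  assumes "finite V" "x \<in> V"
  shows "(\<Sum>p\<in>fpf_invs V. c (p x) * f p) = (\<Sum>y\<in>V - {x}. c y * edge_sum V f x y)"
proof -
  have "(\<Sum>p\<in>fpf_invs V. c (p x) * f p) = (\<Sum>y\<in>V - {x}. \<Sum>p | p \<in> fpf_invs V \<and> p x = y. c (p x) * f p)"
    by (rule sum_fpf_invs_partner[OF assms])
  also have "\<dots> = (\<Sum>y\<in>V - {x}. c y * edge_sum V f x y)"
    by (auto simp: edge_sum_def sum_distrib_left intro!: sum.cong)
  finally show ?thesis .
qed

lemma sum_edge_lift_mult:
  assumes "finite V"
  shows "(\<Sum>p\<in>fpf_invs V. edge_lift V F p * f p) = (\<Sum>x\<in>V. \<Sum>y\<in>V - {x}. F x y * edge_sum V f x y)"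
proof -
  have "(\<Sum>p\<in>fpf_invs V. edge_lift V F p * f p) = (\<Sum>x\<in>V. \<Sum>p\<in>fpf_invs V. F x (p x) * f p)"
    unfolding edge_lift_def sum_distrib_right by (rule sum.swap)
  also have "\<dots> = (\<Sum>x\<in>V. \<Sum>y\<in>V - {x}. F x y * edge_sum V f x y)"
    using assms by (intro sum.cong refl sum_partner_weight) auto
  finally show ?thesis .
qed

text \<open>In the matchings through \<open>{a, b}\<close> this edge contributes
  \<open>F a b\<close> from both ends. At any other \<open>x\<close> the remaining partners occur
  equally often, so the zero row sum leaves a multiple of \<open>F x a + F x b\<close>; the zero
  rows at \<open>a\<close> and \<open>b\<close> turn the total over \<open>x\<close> into a multiple
  of \<open>F a b\<close>.\<close>

lemma edge_sum_edge_lift: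
  assumes V: "finite V" "card V = 2 * Suc (Suc n)" and F: "balanced_weight V F"
    and ab: "a \<in> V" "b \<in> V" "a \<noteq> b"
  shows "edge_sum V (edge_lift V F) a b = 2 * (real (double_fact (2 * n + 1)) + real (double_fact (2 * n - 1))) * F a b"
proof -
  let ?V = "V - {a, b}"
  have card_V': "card ?V = 2 * Suc n"
    using V ab by (subst card_Diff_subset) auto
  have sym: "F x y = F y x" for x y
    by (rule balanced_weight_commute[OF F])
  have row: "(\<Sum>y\<in>V - {x}. F x y) = 0" if "x \<in> V" for x
    by (rule balanced_weight_row[OF F that])
  have split: "(\<Sum>x\<in>V. G x) = G a + G b + (\<Sum>x\<in>?V. G x)" for G :: "'a \<Rightarrow> real"
    using V ab by (simp add: sum.remove[of V a] sum.remove[of "V - {a}" b] Diff_insert2[symmetric] insert_commute)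
  have row': "(\<Sum>x\<in>V - {c, d}. F x c) = - F c d" if "c \<in> V" "d \<in> V" "c \<noteq> d" for c d
  proof -
    have "(\<Sum>x\<in>V - {c}. F c x) = F c d + (\<Sum>x\<in>V - {c} - {d}. F c x)"
      using V that by (intro sum.remove) auto
    then show ?thesis
      using row[OF that(1)] by (simp add: Diff_insert2[of V c "{d}"] sym[of _ c])
  qed
  have row_a: "(\<Sum>x\<in>?V. F x a) = - F a b"
    by (rule row'[OF ab])
  have row_b: "(\<Sum>x\<in>?V. F x b) = - F a b"
    using row'[OF ab(2,1)] ab by (simp add: insert_commute[of b a] sym[of b a])
  have N: "card {p \<in> fpf_invs V. p a = b} = double_fact (2 * n + 1)"
    using card_fpf_invs_double_fact[of ?V "Suc n"] V card_V' card_fpf_invs_edge[OF ab] by simp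
  have inner: "(\<Sum>p | p \<in> fpf_invs V \<and> p a = b. F x (p x)) = - real (double_fact (2 * n - 1)) * (F x a + F x b)"
    if x: "x \<in> ?V" for x
  proof -
    have N2: "card {q \<in> fpf_invs ?V. q x = y} = double_fact (2 * n - 1)" if "y \<in> ?V - {x}" for y
    proof -
      have "card (?V - {x, y}) = 2 * n"
        using V card_V' x that by (subst card_Diff_subset) auto
      then show ?thesis
        using card_fpf_invs_double_fact[of "?V - {x, y}" n] card_fpf_invs_edge[of x ?V y] V x that by auto
    qed
    have "(\<Sum>p | p \<in> fpf_invs V \<and> p a = b. F x (p x)) = (\<Sum>q\<in>fpf_invs ?V. F x (q x))"
      using x by (simp add: sum_fpf_invs_edge[OF ab])
    also have "\<dots> = (\<Sum>y\<in>?V - {x}. \<Sum>q | q \<in> fpf_invs ?V \<and> q x = y. F x (q x))"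
      using V x by (intro sum_fpf_invs_partner) auto
    also have "\<dots> = (\<Sum>y\<in>?V - {x}. real (double_fact (2 * n - 1)) * F x y)"
      by (rule sum.cong) (auto simp: N2)
    also have "\<dots> = real (double_fact (2 * n - 1)) * (\<Sum>y\<in>?V - {x}. F x y)"
      by (simp add: sum_distrib_left)
    also have "(\<Sum>y\<in>?V - {x}. F x y) = - (F x a + F x b)"
    proof -
      have *: "V - {x} - {a} - {b} = ?V - {x}"
        by auto
      have "(\<Sum>y\<in>V - {x}. F x y) = F x a + F x b + (\<Sum>y\<in>?V - {x}. F x y)"
        using V ab x sum.remove[of "V - {x}" a "F x"] sum.remove[of "V - {x} - {a}" b "F x"] by (auto simp: *)
      then show ?thesis using row[of x] x by simp
    qed
    finally show ?thesis by (simp add: algebra_simps)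
  qed
  have "edge_sum V (edge_lift V F) a b = (\<Sum>x\<in>V. \<Sum>p | p \<in> fpf_invs V \<and> p a = b. F x (p x))"
    unfolding edge_sum_def edge_lift_def by (rule sum.swap)
  also have "\<dots> = (\<Sum>p | p \<in> fpf_invs V \<and> p a = b. F a (p a)) + (\<Sum>p | p \<in> fpf_invs V \<and> p a = b. F b (p b))
      + (\<Sum>x\<in>?V. \<Sum>p | p \<in> fpf_invs V \<and> p a = b. F x (p x))"
    by (rule split)
  also have "(\<Sum>p | p \<in> fpf_invs V \<and> p a = b. F a (p a)) = real (double_fact (2 * n + 1)) * F a b"
    using N by simp
  also have "(\<Sum>p | p \<in> fpf_invs V \<and> p a = b. F b (p b)) = (\<Sum>p | p \<in> fpf_invs V \<and> p a = b. F a b)"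
    by (rule sum.cong) (auto simp: fpf_invs_invol sym)
  also have "\<dots> = real (double_fact (2 * n + 1)) * F a b"
    using N by simp
  also have "(\<Sum>x\<in>?V. \<Sum>p | p \<in> fpf_invs V \<and> p a = b. F x (p x))
      = (\<Sum>x\<in>?V. - real (double_fact (2 * n - 1)) * (F x a + F x b))"
    by (intro sum.cong refl inner)
  also have "\<dots> = - real (double_fact (2 * n - 1)) * ((\<Sum>x\<in>?V. F x a) + (\<Sum>x\<in>?V. F x b))"
    by (simp only: sum_distrib_left[symmetric] sum.distrib)
  also have "\<dots> = 2 * real (double_fact (2 * n - 1)) * F a b"
    by (simp add: row_a row_b)
  finally show ?thesis by (simp add: algebra_simps)
qed

lemma edge_lift_swap_conj:
  assumes V: "finite V" and F: "balanced_weight V F"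
    and p: "p \<in> fpf_invs V" "v \<in> V" "w \<in> V - {v, p v}"
  shows "edge_lift V F (swap_conj (p v) w p)
    = edge_lift V F p + 2 * (F v w + F (p v) (p w) - F v (p v) - F w (p w))"
proof -
  have sym: "F x y = F y x" for x y
    by (rule balanced_weight_commute[OF F])
  let ?S = "{v, w, p v, p w}"
  have dist: "p v \<noteq> v" "p w \<noteq> w" "p v \<noteq> p w" "p w \<noteq> v" "w \<noteq> v" "w \<noteq> p v"
    using p by (auto simp: fpf_invs_fixed_iff fpf_invs_eq_iff fpf_invs_invol)
  have S: "?S \<subseteq> V"
    using p by (auto simp: fpf_invs_mem_iff)
  have split: "edge_lift V F q = F v (q v) + F w (q w) + F (p v) (q (p v)) + F (p w) (q (p w)) + (\<Sum>x\<in>V - ?S. F x (q x))" for q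
    unfolding edge_lift_def using sum.subset_diff[OF S V, of "\<lambda>x. F x (q x)"] dist by (simp add: eq_commute)
  have "(\<Sum>x\<in>V - ?S. F x (swap_conj (p v) w p x)) = (\<Sum>x\<in>V - ?S. F x (p x))"
    by (rule sum.cong) (auto simp: swap_conj_eqs(5)[OF p])
  then show ?thesis
    unfolding split swap_conj_eqs(1-4)[OF p]
    using p by (simp add: fpf_invs_invol sym[of w v] sym[of "p v" v] sym[of "p w" w] sym[of "p w" "p v"])
qed

text \<open>Each switch affects two old and two new edges. Summed over \<open>w\<close>, the zero
  rows at \<open>v\<close> and \<open>p v\<close> collapse the new ones to multiples of
  \<open>F v (p v)\<close>, and the old ones involve only \<open>edge_lift V F p\<close> and
  \<open>F v (p v)\<close>.\<close>

lemma switch_sum_edge_lift: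
  assumes V: "finite V" "card V = 2 * Suc (Suc n)" and F: "balanced_weight V F"
    and p: "p \<in> fpf_invs V" "v \<in> V"
  shows "switch_sum V v (edge_lift V F) p = 2 * real n * edge_lift V F p - 4 * (real n + 1) * F v (p v)"
proof -
  let ?W = "V - {v, p v}"
  let ?u = "p v"
  have sym: "F x y = F y x" for x y
    by (rule balanced_weight_commute[OF F])
  have row: "(\<Sum>y\<in>V - {x}. F x y) = 0" if "x \<in> V" for x
    by (rule balanced_weight_row[OF F that])
  have u: "?u \<in> V" "?u \<noteq> v"
    using p by (auto simp: fpf_invs_mem_iff fpf_invs_fixed_iff)
  have cW: "card ?W = 2 * Suc n"
    using V u p by (subst card_Diff_subset) auto
  have s1: "(\<Sum>w\<in>?W. F v w) = - F v ?u"
    using row[OF p(2)] V u by (simp add: sum.remove[of "V - {v}" ?u] Diff_insert2[symmetric] insert_commute)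
  have "(\<Sum>w\<in>?W. F ?u (p w)) = (\<Sum>w\<in>?W. F ?u w)"
    by (rule sum.reindex_bij_witness[where i = p and j = p])
      (use p in \<open>auto simp: fpf_invs_mem_iff fpf_invs_invol fpf_invs_eq_iff\<close>)
  also have "\<dots> = - F v ?u"
    using row[OF u(1)] V u p by (simp add: sum.remove[of "V - {?u}" v] Diff_insert2[symmetric] insert_commute sym[of ?u v])
  finally have s2: "(\<Sum>w\<in>?W. F ?u (p w)) = - F v ?u" .
  have "edge_lift V F p = F v ?u + F ?u (p ?u) + (\<Sum>w\<in>?W. F w (p w))"
    unfolding edge_lift_def using V u p by (simp add: sum.remove[of V v] sum.remove[of "V - {v}" ?u] Diff_insert2[symmetric] insert_commute)
  then have s3: "(\<Sum>w\<in>?W. F w (p w)) = edge_lift V F p - 2 * F v ?u"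
    using p by (simp add: fpf_invs_invol sym[of ?u v])
  have "switch_sum V v (edge_lift V F) p
      = (\<Sum>w\<in>?W. edge_lift V F p + 2 * (F v w + F ?u (p w) - F v ?u - F w (p w)))"
    unfolding switch_sum_def using V F p by (intro sum.cong refl edge_lift_swap_conj) auto
  also have "\<dots> = real (card ?W) * edge_lift V F p + 2 * ((\<Sum>w\<in>?W. F v w) + (\<Sum>w\<in>?W. F ?u (p w)) - real (card ?W) * F v ?u - (\<Sum>w\<in>?W. F w (p w)))"
    by (simp add: sum.distrib sum_subtractf sum_distrib_left[symmetric])
  also have "\<dots> = 2 * real n * edge_lift V F p - 4 * (real n + 1) * F v ?u"
    unfolding s1 s2 s3 cW by (simp add: algebra_simps)
  finally show ?thesis .
qed

section \<open>Averaging the switch form over the edges that miss \<open>v\<close>\<close>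

text \<open>The edge is determined by \<open>x\<close> and \<open>p\<close> as
  \<open>{x, p x}\<close>, and it misses \<open>v\<close> exactly when \<open>x\<close> is neither
  \<open>v\<close> nor \<open>p v\<close>.\<close>

lemma sum_fpf_invs_avoiding:
  fixes h :: "'a \<Rightarrow> ('a \<Rightarrow> 'a) \<Rightarrow> real"
  assumes V: "finite V" "v \<in> V"
  shows "(\<Sum>x\<in>V - {v}. \<Sum>y\<in>V - {v, x}. \<Sum>p | p \<in> fpf_invs V \<and> p x = y. h x p)
    = (\<Sum>p\<in>fpf_invs V. \<Sum>x\<in>V - {v, p v}. h x p)"
proof -
  \<comment> \<open>The conditional makes the range of \<open>x\<close> independent of
    \<open>p\<close>, so that the sums can be exchanged; \<open>p x \<noteq> v\<close> means
    \<open>x \<noteq> p v\<close>.\<close>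
  have "(\<Sum>p\<in>fpf_invs V. \<Sum>x\<in>V - {v, p v}. h x p)
      = (\<Sum>p\<in>fpf_invs V. \<Sum>x\<in>V - {v}. if p x \<noteq> v then h x p else 0)"
    by (intro sum.cong refl sum.mono_neutral_cong_left) (use V in \<open>auto simp: fpf_invs_invol\<close>)
  also have "\<dots> = (\<Sum>x\<in>V - {v}. \<Sum>p\<in>fpf_invs V. if p x \<noteq> v then h x p else 0)"
    by (rule sum.swap)
  also have "\<dots> = (\<Sum>x\<in>V - {v}. \<Sum>y\<in>V - {v, x}. \<Sum>p | p \<in> fpf_invs V \<and> p x = y. h x p)"
  proof (intro sum.cong refl)
    fix x assume x: "x \<in> V - {v}"
    have "(\<Sum>p\<in>fpf_invs V. if p x \<noteq> v then h x p else 0)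
        = (\<Sum>y\<in>V - {x}. \<Sum>p | p \<in> fpf_invs V \<and> p x = y. if p x \<noteq> v then h x p else 0)"
      using V x by (intro sum_fpf_invs_partner) auto
    also have "\<dots> = (\<Sum>y\<in>V - {v, x}. \<Sum>p | p \<in> fpf_invs V \<and> p x = y. h x p)"
      by (rule sum.mono_neutral_cong_right) (use V x in \<open>auto intro!: sum.cong\<close>)
    finally show "(\<Sum>p\<in>fpf_invs V. if p x \<noteq> v then h x p else 0)
        = (\<Sum>y\<in>V - {v, x}. \<Sum>p | p \<in> fpf_invs V \<and> p x = y. h x p)" .
  qed
  finally show ?thesis by simp
qed

lemma swap_conj_add_edge:
  assumes "u \<notin> {x, y}" "w \<notin> {x, y}"
  shows "swap_conj u w q \<circ> transpose x y = swap_conj u w (q \<circ> transpose x y)"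
proof -
  have "transpose u w (transpose x y z) = transpose x y (transpose u w z)" for z
    using assms by (auto simp: transpose_def)
  then show ?thesis by (simp add: swap_conj_def fun_eq_iff)
qed

text \<open>A switch at \<open>v\<close> to \<open>w\<close> keeps every edge off
  \<open>{v, p v, w, p w}\<close>, and is a switch within the matchings containing such an edge. The
  \<open>2 * n\<close> remaining vertices \<open>x\<close> each count it once, through
  \<open>(x, p x)\<close>.\<close>

lemma switch_sum_decompose:
  assumes V: "finite V" "card V = 2 * Suc (Suc n)" and v: "v \<in> V"
  shows "(\<Sum>x\<in>V - {v}. \<Sum>y\<in>V - {v, x}. \<Sum>q\<in>fpf_invs (V - {x, y}).
      f (q \<circ> transpose x y) * switch_sum (V - {x, y}) v (\<lambda>q. f (q \<circ> transpose x y)) q)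
    = 2 * real n * (\<Sum>p\<in>fpf_invs V. f p * switch_sum V v f p)"
proof -
  define h where "h = (\<lambda>x p. f p * (\<Sum>w\<in>V - {v, p v, x, p x}. f (swap_conj (p v) w p)))"
  have eq: "(\<Sum>q\<in>fpf_invs (V - {x, y}).
      f (q \<circ> transpose x y) * switch_sum (V - {x, y}) v (\<lambda>q. f (q \<circ> transpose x y)) q)
      = (\<Sum>p | p \<in> fpf_invs V \<and> p x = y. h x p)" if xy: "x \<in> V - {v}" "y \<in> V - {v, x}" for x y
  proof -
    have "f (q \<circ> transpose x y) * switch_sum (V - {x, y}) v (\<lambda>q. f (q \<circ> transpose x y)) q
        = h x (q \<circ> transpose x y)" if q: "q \<in> fpf_invs (V - {x, y})" for q
    proof -
      have qv: "(q \<circ> transpose x y) v = q v" using xy by (auto simp: transpose_def)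
      have "q v \<in> V - {x, y}" using q xy v by (subst fpf_invs_mem_iff[OF q]) auto
      then have sc: "swap_conj (q v) w q \<circ> transpose x y = swap_conj (q v) w (q \<circ> transpose x y)"
        if "w \<in> V - {x, y} - {v, q v}" for w
        using that by (intro swap_conj_add_edge) auto
      have qy: "q y = y" using q by (simp add: fpf_invs_fixed_iff)
      have set_eq: "V - {x, y} - {v, q v} = V - {v, (q \<circ> transpose x y) v, x, (q \<circ> transpose x y) x}"
        unfolding qv using qy by auto
      have "switch_sum (V - {x, y}) v (\<lambda>q. f (q \<circ> transpose x y)) q
          = (\<Sum>w\<in>V - {x, y} - {v, q v}. f (swap_conj (q v) w (q \<circ> transpose x y)))"
        unfolding switch_sum_def using sc by (intro sum.cong refl) simp
      then show ?thesis unfolding h_def set_eq unfolding qv by simp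
    qed
    then show ?thesis
      using xy by (subst sum_fpf_invs_edge) auto
  qed
  have "(\<Sum>x\<in>V - {v}. \<Sum>y\<in>V - {v, x}. \<Sum>q\<in>fpf_invs (V - {x, y}).
      f (q \<circ> transpose x y) * switch_sum (V - {x, y}) v (\<lambda>q. f (q \<circ> transpose x y)) q)
      = (\<Sum>x\<in>V - {v}. \<Sum>y\<in>V - {v, x}. \<Sum>p | p \<in> fpf_invs V \<and> p x = y. h x p)"
    by (intro sum.cong[OF refl] eq)
  also have "\<dots> = (\<Sum>p\<in>fpf_invs V. \<Sum>x\<in>V - {v, p v}. h x p)"
    by (rule sum_fpf_invs_avoiding[OF V(1) v])
  also have "\<dots> = (\<Sum>p\<in>fpf_invs V. 2 * real n * (f p * switch_sum V v f p))"
  proof (intro sum.cong refl)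
    fix p assume p: "p \<in> fpf_invs V"
    let ?W = "V - {v, p v}"
    have u: "p v \<in> V" "p v \<noteq> v"
      using p v by (auto simp: fpf_invs_mem_iff fpf_invs_fixed_iff)
    have cW: "card ?W = 2 * Suc n"
      using V u v by (subst card_Diff_subset) auto
    have pW: "p w \<in> ?W \<and> p w \<noteq> w" if "w \<in> ?W" for w
      using that p by (auto simp: fpf_invs_mem_iff fpf_invs_fixed_iff fpf_invs_eq_iff fpf_invs_invol)
    have c: "card (?W - {w, p w}) = 2 * n" if "w \<in> ?W" for w
      using cW pW[OF that] that V by (subst card_Diff_subset) auto
    have "(\<Sum>x\<in>?W. \<Sum>w\<in>V - {v, p v, x, p x}. f (swap_conj (p v) w p))
        = (\<Sum>x\<in>?W. \<Sum>w | w \<in> ?W \<and> w \<notin> {x, p x}. f (swap_conj (p v) w p))"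
      by (intro sum.cong) auto
    \<comment> \<open>For an involution, \<open>w\<close> avoids \<open>{x, p x}\<close> exactly
      when \<open>x\<close> avoids \<open>{w, p w}\<close>.\<close>
    also have "\<dots> = (\<Sum>w\<in>?W. \<Sum>x | x \<in> ?W \<and> w \<notin> {x, p x}. f (swap_conj (p v) w p))"
      using V by (intro sum.swap_restrict) auto
    also have "\<dots> = (\<Sum>w\<in>?W. \<Sum>x\<in>?W - {w, p w}. f (swap_conj (p v) w p))"
      using p by (intro sum.cong refl) (auto simp: fpf_invs_invol)
    also have "\<dots> = 2 * real n * switch_sum V v f p"
      by (simp add: c switch_sum_def sum_distrib_left)
    finally show "(\<Sum>x\<in>?W. h x p) = 2 * real n * (f p * switch_sum V v f p)"
      by (simp add: h_def sum_distrib_left[symmetric])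
  qed
  finally show ?thesis by (simp add: sum_distrib_left)
qed

lemma edge_sum_card4:
  assumes V: "finite V" "card V = 4" and p: "p \<in> fpf_invs V" "v \<in> V"
  shows "edge_sum V f v (p v) = f p"
proof -
  have u: "p v \<in> V" "v \<noteq> p v"
    using p by (auto simp: fpf_invs_mem_iff fpf_invs_fixed_iff dest: sym)
  have "card (V - {v, p v}) = 2 * 1"
    using V u p by (subst card_Diff_subset) auto
  then have "card {r \<in> fpf_invs V. r v = p v} = 1"
    using card_fpf_invs_double_fact[of "V - {v, p v}" 1] card_fpf_invs_edge[OF p(2) u] V by simp
  then obtain r where r: "{r \<in> fpf_invs V. r v = p v} = {r}"
    by (auto simp: card_1_singleton_iff)
  moreover have "p \<in> {r \<in> fpf_invs V. r v = p v}" using p by simp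
  ultimately have "{r \<in> fpf_invs V. r v = p v} = {p}" by auto
  then show ?thesis by (simp add: edge_sum_def)
qed

text \<open>An edge determines its matching on four vertices, so the switches reach each of the
  other two matchings once: the operator is the all-ones matrix minus the identity.\<close>

lemma switch_sum_card4:
  assumes V: "finite V" "card V = 4" and p: "p \<in> fpf_invs V" "v \<in> V"
  shows "switch_sum V v f p = (\<Sum>q\<in>fpf_invs V. f q) - f p"
proof -
  have u: "p v \<in> V" "p v \<noteq> v"
    using p by (auto simp: fpf_invs_mem_iff fpf_invs_fixed_iff)
  have "f (swap_conj (p v) w p) = edge_sum V f v w" if w: "w \<in> V - {v, p v}" for w
    using edge_sum_card4[OF V swap_conj_mem[OF p(1) u(1), of w] p(2), of f] w p swap_conj_eqs(1)[OF p w] by simp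
  then have "switch_sum V v f p = (\<Sum>w\<in>V - {v} - {p v}. edge_sum V f v w)"
    unfolding switch_sum_def by (intro sum.cong) auto
  also have "\<dots> = (\<Sum>w\<in>V - {v}. edge_sum V f v w) - edge_sum V f v (p v)"
    using V u by (subst sum_diff1) auto
  finally show ?thesis
    using V p by (simp add: sum_edge_sum edge_sum_card4)
qed

lemma sum_squares_avoiding:
  assumes V: "finite V" "card V = 2 * Suc (Suc n)" and v: "v \<in> V"
  shows "(\<Sum>x\<in>V - {v}. \<Sum>y\<in>V - {v, x}. \<Sum>q\<in>fpf_invs (V - {x, y}). (f (q \<circ> transpose x y))\<^sup>2)
    = 2 * (real n + 1) * (\<Sum>p\<in>fpf_invs V. (f p)\<^sup>2)"
proof -
  have eq: "(\<Sum>q\<in>fpf_invs (V - {x, y}). (f (q \<circ> transpose x y))\<^sup>2) = (\<Sum>p | p \<in> fpf_invs V \<and> p x = y. (f p)\<^sup>2)"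
    if "x \<in> V - {v}" "y \<in> V - {v, x}" for x y
    using that by (subst sum_fpf_invs_edge) auto
  have "(\<Sum>x\<in>V - {v}. \<Sum>y\<in>V - {v, x}. \<Sum>q\<in>fpf_invs (V - {x, y}). (f (q \<circ> transpose x y))\<^sup>2)
      = (\<Sum>x\<in>V - {v}. \<Sum>y\<in>V - {v, x}. \<Sum>p | p \<in> fpf_invs V \<and> p x = y. (f p)\<^sup>2)"
    by (intro sum.cong[OF refl] eq)
  also have "\<dots> = (\<Sum>p\<in>fpf_invs V. \<Sum>x\<in>V - {v, p v}. (f p)\<^sup>2)"
    by (rule sum_fpf_invs_avoiding[OF V(1) v])
  also have "\<dots> = (\<Sum>p\<in>fpf_invs V. 2 * (real n + 1) * (f p)\<^sup>2)"
  proof (intro sum.cong refl)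
    fix p assume p: "p \<in> fpf_invs V"
    have "p v \<in> V" "p v \<noteq> v"
      using p v by (auto simp: fpf_invs_mem_iff fpf_invs_fixed_iff)
    then have "card (V - {v, p v}) = 2 * Suc n"
      using V v by (subst card_Diff_subset) auto
    then show "(\<Sum>x\<in>V - {v, p v}. (f p)\<^sup>2) = 2 * (real n + 1) * (f p)\<^sup>2"
      by simp
  qed
  finally show ?thesis by (simp add: sum_distrib_left)
qed

text \<open>On four vertices the form is the square of the sum minus the sum of squares. In the step
  the bound for two vertices fewer, with constant \<open>n\<close>, is averaged over the edges
  missing \<open>v\<close>; the factors \<open>2 * (n + 1)\<close> from the squares and
  \<open>2 * n\<close> from the form turn \<open>n\<close> into \<open>n + 1\<close>.\<close>

lemma switch_sum_form_ge:
  assumes "finite V" "card V = 2 * Suc (Suc n)" "v \<in> V"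
  shows "- (real n + 1) * (\<Sum>p\<in>fpf_invs V. (f p)\<^sup>2) \<le> (\<Sum>p\<in>fpf_invs V. f p * switch_sum V v f p)"
  using assms
proof (induction n arbitrary: V f)
  case 0
  then have "(\<Sum>p\<in>fpf_invs V. f p * switch_sum V v f p)
      = (\<Sum>p\<in>fpf_invs V. f p * (\<Sum>q\<in>fpf_invs V. f q) - (f p)\<^sup>2)"
    by (intro sum.cong refl) (simp add: switch_sum_card4 algebra_simps power2_eq_square)
  also have "\<dots> = (\<Sum>q\<in>fpf_invs V. f q)\<^sup>2 - (\<Sum>p\<in>fpf_invs V. (f p)\<^sup>2)"
    by (simp only: sum_subtractf sum_distrib_right[symmetric] power2_eq_square[of "sum f _"])
  finally show ?case by simp
next
  case (Suc k)
  note V = Suc.prems(1,2) and v = Suc.prems(3)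
  have step: "- (real k + 1) * (\<Sum>q\<in>fpf_invs (V - {x, y}). (f (q \<circ> transpose x y))\<^sup>2)
      \<le> (\<Sum>q\<in>fpf_invs (V - {x, y}).
      f (q \<circ> transpose x y) * switch_sum (V - {x, y}) v (\<lambda>q. f (q \<circ> transpose x y)) q)"
    if "x \<in> V - {v}" "y \<in> V - {v, x}" for x y
  proof -
    have "card (V - {x, y}) = 2 * Suc (Suc k)"
      using V that by (subst card_Diff_subset) auto
    then show ?thesis using V v that by (intro Suc.IH) auto
  qed
  have "- (real k + 1) * (\<Sum>x\<in>V - {v}. \<Sum>y\<in>V - {v, x}. \<Sum>q\<in>fpf_invs (V - {x, y}). (f (q \<circ> transpose x y))\<^sup>2)
      \<le> (\<Sum>x\<in>V - {v}. \<Sum>y\<in>V - {v, x}. \<Sum>q\<in>fpf_invs (V - {x, y}).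
      f (q \<circ> transpose x y) * switch_sum (V - {x, y}) v (\<lambda>q. f (q \<circ> transpose x y)) q)"
    unfolding sum_distrib_left[of "- (real k + 1)" _ "V - _"] by (intro sum_mono step)
  then have "- (real k + 1) * (2 * (real (Suc k) + 1) * (\<Sum>p\<in>fpf_invs V. (f p)\<^sup>2))
      \<le> 2 * real (Suc k) * (\<Sum>p\<in>fpf_invs V. f p * switch_sum V v f p)"
    unfolding sum_squares_avoiding[OF V v] switch_sum_decompose[OF V v] .
  then have "(2 * (real k + 1)) * (- (real (Suc k) + 1) * (\<Sum>p\<in>fpf_invs V. (f p)\<^sup>2))
      \<le> (2 * (real k + 1)) * (\<Sum>p\<in>fpf_invs V. f p * switch_sum V v f p)"
    by (simp add: algebra_simps)
  then show ?case
    by (rule mult_left_le_imp_le) simp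
qed

text \<open>As \<open>edge_sum\<close> after \<open>edge_lift\<close> multiplies balanced weights by
  \<open>K\<close>, the subtracted quotient has the same edge sums as \<open>f\<close>.\<close>

lemma edge_sum_residual:
  assumes V: "finite V" "card V = 2 * Suc (Suc n)" and F: "balanced_weight V (edge_sum V f)"
    and ab: "a \<in> V" "b \<in> V" "a \<noteq> b"
  defines "K \<equiv> 2 * (real (double_fact (2 * n + 1)) + real (double_fact (2 * n - 1)))"
  shows "edge_sum V (\<lambda>p. f p - edge_lift V (edge_sum V f) p / K) a b = 0"
proof -
  have "K > 0" unfolding K_def using double_fact_pos[of "2 * n + 1"] by simp
  moreover have "edge_sum V (\<lambda>p. f p - edge_lift V (edge_sum V f) p / K) a b
      = edge_sum V f a b - edge_sum V (edge_lift V (edge_sum V f)) a b / K"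
    by (simp add: edge_sum_def sum_subtractf sum_divide_distrib)
  ultimately show ?thesis
    using edge_sum_edge_lift[OF V F ab] by (simp add: K_def)
qed

lemma switch_sum_add_scaled:
  "switch_sum V v (\<lambda>p. f p + c * g p) p = switch_sum V v f p + c * switch_sum V v g p"
  by (simp add: switch_sum_def sum.distrib sum_distrib_left)

lemma switch_sum_form_le:
  assumes "finite V" "card V = 2 * Suc (Suc n)" "v \<in> V" "(\<Sum>p\<in>fpf_invs V. f p) = 0"
  shows "(\<Sum>p\<in>fpf_invs V. f p * switch_sum V v f p) \<le> 2 * real n * (\<Sum>p\<in>fpf_invs V. (f p)\<^sup>2)"
  using assms
proof (induction n arbitrary: V f rule: less_induct)
  case (less n)
  note V = less.prems(1,2) and v = less.prems(3)
  \<comment> \<open>\<open>P / K\<close> is the orthogonal projection of \<open>f\<close> onto the span of the indicators of the sets of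
    matchings containing a given edge; on this span \<open>switch_sum\<close> is explicit, and the residual \<open>q\<close>
    still has sum zero after fixing an edge, so that the induction hypothesis applies to it.\<close>
  define F where "F = edge_sum V f"
  define K where "K = 2 * (real (double_fact (2 * n + 1)) + real (double_fact (2 * n - 1)))"
  define P where "P = edge_lift V F"
  define q where "q = (\<lambda>p. f p - P p / K)"
  have F: "balanced_weight V F"
    unfolding F_def by (rule balanced_weight_edge_sum[OF V(1) less.prems(4)])
  have q0: "edge_sum V q a b = 0" if "a \<in> V" "b \<in> V - {a}" for a b
    using edge_sum_residual[OF V F[unfolded F_def], of a b] that unfolding q_def P_def K_def F_def by auto
  have Pq: "(\<Sum>p\<in>fpf_invs V. P p * q p) = 0"
    unfolding P_def sum_edge_lift_mult[OF V(1)] by (simp add: q0)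
  have Fq: "(\<Sum>p\<in>fpf_invs V. F v (p v) * q p) = 0"
    unfolding sum_partner_weight[OF V(1) v, of "F v"] using v by (simp add: q0)
  \<comment> \<open>The term with \<open>F v (p v)\<close> in \<open>TP\<close> can only lower the
    form at \<open>P\<close>, because its pairing with \<open>P\<close> is, up to a negative factor,
    a sum of squares.\<close>
  have FP: "0 \<le> (\<Sum>p\<in>fpf_invs V. F v (p v) * P p)"
    unfolding sum_partner_weight[OF V(1) v, of "F v"]
  proof (intro sum_nonneg)
    fix y assume "y \<in> V - {v}"
    then have "edge_sum V P v y = K * F v y"
      unfolding P_def K_def using v by (intro edge_sum_edge_lift[OF V F]) auto
    then have "F v y * edge_sum V P v y = K * (F v y)\<^sup>2" by (simp add: power2_eq_square)
    moreover have "0 \<le> K" by (simp add: K_def)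
    ultimately show "0 \<le> F v y * edge_sum V P v y" by simp
  qed
  have TP: "switch_sum V v P p = 2 * real n * P p - 4 * (real n + 1) * F v (p v)" if "p \<in> fpf_invs V" for p
    unfolding P_def by (rule switch_sum_edge_lift[OF V F that v])
  \<comment> \<open>\<open>TP\<close> places the image of \<open>P\<close> in the span of
    \<open>P\<close> and \<open>F v (p v)\<close>, both orthogonal to \<open>q\<close>; so the mixed
    terms vanish.\<close>
  have qTP: "(\<Sum>p\<in>fpf_invs V. switch_sum V v P p * q p) = 0"
  proof -
    have "(\<Sum>p\<in>fpf_invs V. switch_sum V v P p * q p)
        = (\<Sum>p\<in>fpf_invs V. 2 * real n * (P p * q p) - 4 * (real n + 1) * (F v (p v) * q p))"
      by (intro sum.cong refl) (simp add: TP algebra_simps)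
    also have "\<dots> = 2 * real n * (\<Sum>p\<in>fpf_invs V. P p * q p) - 4 * (real n + 1) * (\<Sum>p\<in>fpf_invs V. F v (p v) * q p)"
      by (simp add: sum_subtractf sum_distrib_left)
    finally show ?thesis by (simp add: Pq Fq)
  qed
  have PTP: "(\<Sum>p\<in>fpf_invs V. P p * switch_sum V v P p) \<le> 2 * real n * (\<Sum>p\<in>fpf_invs V. (P p)\<^sup>2)"
  proof -
    have "(\<Sum>p\<in>fpf_invs V. P p * switch_sum V v P p)
        = (\<Sum>p\<in>fpf_invs V. 2 * real n * (P p)\<^sup>2 - 4 * (real n + 1) * (F v (p v) * P p))"
      by (intro sum.cong refl) (simp add: TP algebra_simps power2_eq_square)
    also have "\<dots> = 2 * real n * (\<Sum>p\<in>fpf_invs V. (P p)\<^sup>2) - 4 * (real n + 1) * (\<Sum>p\<in>fpf_invs V. F v (p v) * P p)"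
      by (simp add: sum_subtractf sum_distrib_left)
    finally show ?thesis using FP by simp
  qed
  have qTq: "(\<Sum>p\<in>fpf_invs V. q p * switch_sum V v q p) \<le> 2 * real n * (\<Sum>p\<in>fpf_invs V. (q p)\<^sup>2)"
  proof (cases n)
    case 0
    \<comment> \<open>On four vertices every value of \<open>q\<close> is one of its edge
      sums.\<close>
    have "q p = 0" if p: "p \<in> fpf_invs V" for p
    proof -
      have "p v \<in> V - {v}" using p v by (auto simp: fpf_invs_mem_iff fpf_invs_fixed_iff)
      then show ?thesis using edge_sum_card4[of V p v q] q0[of v "p v"] V v p 0 by simp
    qed
    then show ?thesis by (simp add: 0)
  next
    case (Suc k)
    have step: "(\<Sum>r\<in>fpf_invs (V - {x, y}).
        q (r \<circ> transpose x y) * switch_sum (V - {x, y}) v (\<lambda>r. q (r \<circ> transpose x y)) r)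
        \<le> 2 * real k * (\<Sum>r\<in>fpf_invs (V - {x, y}). (q (r \<circ> transpose x y))\<^sup>2)"
      if xy: "x \<in> V - {v}" "y \<in> V - {v, x}" for x y
    proof (rule less.IH)
      show "k < n" by (simp add: Suc)
      show "card (V - {x, y}) = 2 * Suc (Suc k)"
        using V xy Suc by (subst card_Diff_subset) auto
      have "(\<Sum>r\<in>fpf_invs (V - {x, y}). q (r \<circ> transpose x y)) = edge_sum V q x y"
        unfolding edge_sum_def using xy by (subst sum_fpf_invs_edge) auto
      then show "(\<Sum>r\<in>fpf_invs (V - {x, y}). q (r \<circ> transpose x y)) = 0"
        using q0[of x y] xy by simp
    qed (use V v xy in auto)
    have "(\<Sum>x\<in>V - {v}. \<Sum>y\<in>V - {v, x}. \<Sum>r\<in>fpf_invs (V - {x, y}).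
        q (r \<circ> transpose x y) * switch_sum (V - {x, y}) v (\<lambda>r. q (r \<circ> transpose x y)) r)
        \<le> 2 * real k * (\<Sum>x\<in>V - {v}. \<Sum>y\<in>V - {v, x}. \<Sum>r\<in>fpf_invs (V - {x, y}). (q (r \<circ> transpose x y))\<^sup>2)"
      unfolding sum_distrib_left[of "2 * real k" _ "V - _"] by (intro sum_mono step)
    then have "2 * real n * (\<Sum>p\<in>fpf_invs V. q p * switch_sum V v q p)
        \<le> 2 * real k * (2 * (real n + 1) * (\<Sum>p\<in>fpf_invs V. (q p)\<^sup>2))"
      unfolding sum_squares_avoiding[OF V v] switch_sum_decompose[OF V v] .
    also have "\<dots> = (2 * real k * (2 * (real n + 1))) * (\<Sum>p\<in>fpf_invs V. (q p)\<^sup>2)"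
      by simp
    \<comment> \<open>With \<open>k = n - 1\<close> this is
      \<open>(n - 1) * (n + 1) \<le> n * n\<close>.\<close>
    also have "\<dots> \<le> (2 * real n * (2 * real n)) * (\<Sum>p\<in>fpf_invs V. (q p)\<^sup>2)"
      by (intro mult_right_mono sum_nonneg) (auto simp: Suc algebra_simps)
    finally have "2 * real n * (\<Sum>p\<in>fpf_invs V. q p * switch_sum V v q p)
        \<le> 2 * real n * (2 * real n * (\<Sum>p\<in>fpf_invs V. (q p)\<^sup>2))"
      by (simp add: mult.assoc)
    then show ?thesis
      by (rule mult_left_le_imp_le) (simp add: Suc)
  qed
  have f: "f = (\<lambda>p. q p + (1 / K) * P p)"
    by (simp add: q_def)
  have "(\<Sum>p\<in>fpf_invs V. f p * switch_sum V v f p)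
      = (\<Sum>p\<in>fpf_invs V. q p * switch_sum V v q p + (1 / K) * (switch_sum V v P p * q p)
        + (1 / K) * (P p * switch_sum V v q p) + (1 / K)\<^sup>2 * (P p * switch_sum V v P p))"
    unfolding f switch_sum_add_scaled by (intro sum.cong refl) (simp only: power2_eq_square algebra_simps)
  also have "\<dots> = (\<Sum>p\<in>fpf_invs V. q p * switch_sum V v q p) + (1 / K)\<^sup>2 * (\<Sum>p\<in>fpf_invs V. P p * switch_sum V v P p)"
    unfolding sum.distrib sum_distrib_left[symmetric] switch_sum_sym[OF V(1) v, of P q] qTP by simp
  also have "\<dots> \<le> 2 * real n * (\<Sum>p\<in>fpf_invs V. (q p)\<^sup>2) + (1 / K)\<^sup>2 * (2 * real n * (\<Sum>p\<in>fpf_invs V. (P p)\<^sup>2))"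
    by (intro add_mono mult_left_mono qTq PTP) simp
  also have "\<dots> = 2 * real n * ((\<Sum>p\<in>fpf_invs V. (q p)\<^sup>2) + 2 * (1 / K) * (\<Sum>p\<in>fpf_invs V. P p * q p) + (1 / K)\<^sup>2 * (\<Sum>p\<in>fpf_invs V. (P p)\<^sup>2))"
    unfolding Pq by (simp add: algebra_simps)
  also have "(\<Sum>p\<in>fpf_invs V. (q p)\<^sup>2) + 2 * (1 / K) * (\<Sum>p\<in>fpf_invs V. P p * q p) + (1 / K)\<^sup>2 * (\<Sum>p\<in>fpf_invs V. (P p)\<^sup>2)
      = (\<Sum>p\<in>fpf_invs V. (f p)\<^sup>2)"
    unfolding f sum_distrib_left sum.distrib[symmetric] by (intro sum.cong refl) (simp add: power2_eq_square algebra_simps)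
  finally show ?case .
qed

section \<open>Norm of the switch operator on functions of sum zero\<close>

lemma sum_switch_sum:
  assumes V: "finite V" "card V = 2 * Suc n" and v: "v \<in> V"
  shows "(\<Sum>p\<in>fpf_invs V. switch_sum V v f p) = 2 * real n * (\<Sum>p\<in>fpf_invs V. f p)"
proof -
  have "switch_sum V v (\<lambda>_. 1) p = 2 * real n" if p: "p \<in> fpf_invs V" for p
  proof -
    have "p v \<in> V" "p v \<noteq> v"
      using p v by (auto simp: fpf_invs_mem_iff fpf_invs_fixed_iff)
    then have "card (V - {v, p v}) = 2 * n"
      using V v by (subst card_Diff_subset) auto
    then show ?thesis by (simp add: switch_sum_def)
  qed
  then show ?thesis
    using switch_sum_sym[OF V(1) v, of "\<lambda>_. 1" f] by (simp add: sum_distrib_left)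
qed

text \<open>Instead of diagonalising, apply the upper form bound to \<open>f + h / c\<close> and the
  lower one to \<open>f - h / c\<close>, where \<open>h\<close> is the image of \<open>f\<close> and
  \<open>c = 2 * n\<close>. In the difference only the squared norms of \<open>f\<close> and
  \<open>h\<close> survive.\<close>

lemma switch_sum_contraction:
  assumes V: "finite V" "card V = 2 * Suc (Suc n)" and v: "v \<in> V" and n: "n \<ge> 1"
    and f0: "(\<Sum>p\<in>fpf_invs V. f p) = 0"
  shows "(\<Sum>p\<in>fpf_invs V. (switch_sum V v f p)\<^sup>2) \<le> (2 * real n)\<^sup>2 * (\<Sum>p\<in>fpf_invs V. (f p)\<^sup>2)"
proof -
  define c where "c = 2 * real n"
  \<comment> \<open>From \<open>n \<ge> 1\<close> the lower bound \<open>- (n + 1)\<close> is at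
    least \<open>- c\<close>, so \<open>c\<close> serves on both sides.\<close>
  have c: "c > 0" "real n + 1 \<le> c" using n by (auto simp: c_def)
  define h where "h = switch_sum V v f"
  define A where "A = (\<Sum>p\<in>fpf_invs V. (f p)\<^sup>2)"
  define X where "X = (\<Sum>p\<in>fpf_invs V. (h p)\<^sup>2)"
  define Y where "Y = (\<Sum>p\<in>fpf_invs V. h p * f p)"
  define B where "B = (\<Sum>p\<in>fpf_invs V. f p * switch_sum V v f p) + (1 / c)\<^sup>2 * (\<Sum>p\<in>fpf_invs V. h p * switch_sum V v h p)"
  have h0: "(\<Sum>p\<in>fpf_invs V. h p) = 0"
    unfolding h_def using sum_switch_sum[of V "Suc n" v f] V v f0 by simp
  \<comment> \<open>\<open>B\<close> collects the terms that are unchanged under \<open>d\<close> to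
    \<open>- d\<close>; each of the two mixed terms is \<open>d * X\<close> by
    self-adjointness.\<close>
  have form: "(\<Sum>p\<in>fpf_invs V. (f p + d * h p) * switch_sum V v (\<lambda>p. f p + d * h p) p) = B + 2 * d * X"
    if "d\<^sup>2 = (1 / c)\<^sup>2" for d
  proof -
    have "(\<Sum>p\<in>fpf_invs V. (f p + d * h p) * switch_sum V v (\<lambda>p. f p + d * h p) p)
        = (\<Sum>p\<in>fpf_invs V. f p * switch_sum V v f p + d * (f p * switch_sum V v h p) + d * (h p * switch_sum V v f p) + d\<^sup>2 * (h p * switch_sum V v h p))"
      unfolding switch_sum_add_scaled by (intro sum.cong refl) (simp only: power2_eq_square algebra_simps)
    also have "\<dots> = B + 2 * d * X"
      unfolding sum.distrib sum_distrib_left[symmetric] switch_sum_sym[OF V(1) v, of f h] that B_def X_def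
      by (simp add: h_def[symmetric] power2_eq_square)
    finally show ?thesis .
  qed
  have square: "(\<Sum>p\<in>fpf_invs V. (f p + d * h p)\<^sup>2) = A + 2 * d * Y + (1 / c)\<^sup>2 * X"
    if "d\<^sup>2 = (1 / c)\<^sup>2" for d
    unfolding A_def X_def Y_def that[symmetric] sum_distrib_left sum.distrib[symmetric]
    by (intro sum.cong refl) (simp add: power2_eq_square algebra_simps)
  have zero: "(\<Sum>p\<in>fpf_invs V. f p + d * h p) = 0" for d
    by (simp add: sum.distrib sum_distrib_left[symmetric] f0 h0)
  have "B + 2 * (1 / c) * X \<le> c * (A + 2 * (1 / c) * Y + (1 / c)\<^sup>2 * X)"
    using switch_sum_form_le[OF V v zero, of "1 / c"] by (simp only: form square c_def[symmetric])
  moreover have "- c * (A + 2 * (- 1 / c) * Y + (1 / c)\<^sup>2 * X) \<le> B + 2 * (- 1 / c) * X"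
  proof -
    have sq: "(- 1 / c)\<^sup>2 = (1 / c)\<^sup>2" by (simp add: power2_eq_square)
    have "- c * (\<Sum>p\<in>fpf_invs V. (f p + (- 1 / c) * h p)\<^sup>2) \<le> - (real n + 1) * (\<Sum>p\<in>fpf_invs V. (f p + (- 1 / c) * h p)\<^sup>2)"
      using c by (intro mult_right_mono sum_nonneg) auto
    also have "\<dots> \<le> (\<Sum>p\<in>fpf_invs V. (f p + (- 1 / c) * h p) * switch_sum V v (\<lambda>p. f p + (- 1 / c) * h p) p)"
      by (rule switch_sum_form_ge[OF V v])
    finally show ?thesis by (simp only: form[OF sq] square[OF sq])
  qed
  moreover have "c * (A + 2 * (1 / c) * Y + (1 / c)\<^sup>2 * X) = c * A + 2 * Y + X / c"
      "- c * (A + 2 * (- 1 / c) * Y + (1 / c)\<^sup>2 * X) = - (c * A) + 2 * Y - X / c"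
      "2 * (1 / c) * X = 2 * (X / c)" "2 * (- 1 / c) * X = - 2 * (X / c)"
    using c by (simp_all add: field_simps power2_eq_square)
  ultimately have "X / c \<le> c * A"
    by linarith
  then have "X \<le> c\<^sup>2 * A"
    using c by (simp add: field_simps power2_eq_square)
  then show ?thesis by (simp add: X_def A_def h_def c_def)
qed

section \<open>A weighted derangement kernel\<close>

definition bilinear_sum :: "'b set \<Rightarrow> ('b \<Rightarrow> 'b \<Rightarrow> real) \<Rightarrow> ('b \<Rightarrow> real) \<Rightarrow> ('b \<Rightarrow> real) \<Rightarrow> real" where
  "bilinear_sum S A f g = (\<Sum>p\<in>S. \<Sum>q\<in>S. f p * A p q * g q)"

text \<open>A weighted adjacency matrix of the graph of disjoint matchings, normalised to row and
  column sums 1. Symmetry is not recorded, hence the separate conditions on rows and columns and the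
  bilinear norm bound.\<close>

definition derangement_kernel :: "'a set \<Rightarrow> real \<Rightarrow> (('a \<Rightarrow> 'a) \<Rightarrow> ('a \<Rightarrow> 'a) \<Rightarrow> real) \<Rightarrow> bool" where
  "derangement_kernel V c A \<longleftrightarrow>
    (\<forall>p\<in>fpf_invs V. \<forall>q\<in>fpf_invs V. (\<exists>x\<in>V. p x = q x) \<longrightarrow> A p q = 0) \<and>
    (\<forall>p\<in>fpf_invs V. (\<Sum>q\<in>fpf_invs V. A p q) = 1) \<and>
    (\<forall>q\<in>fpf_invs V. (\<Sum>p\<in>fpf_invs V. A p q) = 1) \<and>
    (\<forall>f g. (\<Sum>p\<in>fpf_invs V. f p) = 0 \<longrightarrow> (\<Sum>p\<in>fpf_invs V. g p) = 0 \<longrightarrow>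
      \<bar>bilinear_sum (fpf_invs V) A f g\<bar> \<le> c * L2_set f (fpf_invs V) * L2_set g (fpf_invs V))"

lemma derangement_kernelD:
  assumes "derangement_kernel V c A"
  shows "p \<in> fpf_invs V \<Longrightarrow> q \<in> fpf_invs V \<Longrightarrow> x \<in> V \<Longrightarrow> p x = q x \<Longrightarrow> A p q = 0"
    and "p \<in> fpf_invs V \<Longrightarrow> (\<Sum>q\<in>fpf_invs V. A p q) = 1"
    and "q \<in> fpf_invs V \<Longrightarrow> (\<Sum>p\<in>fpf_invs V. A p q) = 1"
    and "(\<Sum>p\<in>fpf_invs V. f p) = 0 \<Longrightarrow> (\<Sum>p\<in>fpf_invs V. g p) = 0 \<Longrightarrow>
      \<bar>bilinear_sum (fpf_invs V) A f g\<bar> \<le> c * L2_set f (fpf_invs V) * L2_set g (fpf_invs V)"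
  using assms unfolding derangement_kernel_def by blast+

text \<open>Unit row and column sums reduce the cross terms to multiples of the sums of
  \<open>f\<close> and \<open>g\<close>, which vanish.\<close>

lemma bilinear_sum_shift:
  assumes S: "finite S" and row: "\<And>p. p \<in> S \<Longrightarrow> (\<Sum>q\<in>S. A p q) = 1" and col: "\<And>q. q \<in> S \<Longrightarrow> (\<Sum>p\<in>S. A p q) = 1"
    and f: "(\<Sum>p\<in>S. f p) = 0" and g: "(\<Sum>q\<in>S. g q) = 0"
  shows "bilinear_sum S A (\<lambda>p. f p + a) (\<lambda>q. g q + b) = bilinear_sum S A f g + real (card S) * a * b"
proof -
  have 1: "(\<Sum>p\<in>S. \<Sum>q\<in>S. f p * A p q * b) = 0"
  proof -
    have "(\<Sum>p\<in>S. \<Sum>q\<in>S. f p * A p q * b) = (\<Sum>p\<in>S. f p * (\<Sum>q\<in>S. A p q) * b)"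
      by (simp add: sum_distrib_left sum_distrib_right)
    also have "\<dots> = (\<Sum>p\<in>S. f p) * b"
      by (simp add: row sum_distrib_right)
    finally show ?thesis by (simp add: f)
  qed
  have 2: "(\<Sum>p\<in>S. \<Sum>q\<in>S. a * A p q * g q) = 0"
  proof -
    have "(\<Sum>p\<in>S. \<Sum>q\<in>S. a * A p q * g q) = (\<Sum>q\<in>S. \<Sum>p\<in>S. a * A p q * g q)"
      by (rule sum.swap)
    also have "\<dots> = (\<Sum>q\<in>S. a * (\<Sum>p\<in>S. A p q) * g q)"
      by (simp add: sum_distrib_left sum_distrib_right)
    also have "\<dots> = a * (\<Sum>q\<in>S. g q)"
      by (simp add: col sum_distrib_left)
    finally show ?thesis by (simp add: g)
  qed
  have 3: "(\<Sum>p\<in>S. \<Sum>q\<in>S. a * A p q * b) = real (card S) * a * b"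
  proof -
    have "(\<Sum>p\<in>S. \<Sum>q\<in>S. a * A p q * b) = (\<Sum>p\<in>S. a * (\<Sum>q\<in>S. A p q) * b)"
      by (simp add: sum_distrib_left sum_distrib_right)
    then show ?thesis by (simp add: row)
  qed
  have "bilinear_sum S A (\<lambda>p. f p + a) (\<lambda>q. g q + b)
      = bilinear_sum S A f g + (\<Sum>p\<in>S. \<Sum>q\<in>S. f p * A p q * b) + (\<Sum>p\<in>S. \<Sum>q\<in>S. a * A p q * g q)
        + (\<Sum>p\<in>S. \<Sum>q\<in>S. a * A p q * b)"
    unfolding bilinear_sum_def sum.distrib[symmetric] by (intro sum.cong refl) (simp add: algebra_simps)
  then show ?thesis by (simp add: 1 2 3)
qed

text \<open>The three matchings are pairwise disjoint, and half of all-ones minus identity acts as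
  \<open>- 1 / 2\<close> on functions of sum zero.\<close>

lemma derangement_kernel_card4:
  assumes V: "finite V" "card V = 4"
  shows "derangement_kernel V (1 / 2) (\<lambda>p q. if p = q then 0 else 1 / 2)"
proof -
  let ?A = "\<lambda>p q. if p = q then 0 else 1 / 2 :: real"
  let ?I = "fpf_invs V"
  have cI: "card ?I = 3"
    using card_fpf_invs_double_fact[of V 2] V by (simp add: numeral_eq_Suc)
  have eq: "p = q" if "p \<in> ?I" "q \<in> ?I" "x \<in> V" "p x = q x" for p q x
  proof -
    define d :: "('a \<Rightarrow> 'a) \<Rightarrow> real" where "d = (\<lambda>r. if r = p then 1 else 0)"
    have "d p = d q"
      using edge_sum_card4[OF V that(1,3), of d] edge_sum_card4[OF V that(2,3), of d]
      unfolding that(4) by (rule trans[OF sym])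
    then show ?thesis by (simp add: d_def split: if_splits)
  qed
  have A: "?A p q = 1 / 2 - (if p = q then 1 / 2 else 0)" for p q :: "'a \<Rightarrow> 'a"
    by simp
  have row: "(\<Sum>q\<in>?I. ?A p q) = 1" if "p \<in> ?I" for p
    unfolding A sum_subtractf using that V by (simp add: cI sum.delta)
  have col: "(\<Sum>p\<in>?I. ?A p q) = 1" if "q \<in> ?I" for q
    unfolding A sum_subtractf using that V by (simp add: cI sum.delta')
  have "\<bar>bilinear_sum ?I ?A f g\<bar> \<le> 1 / 2 * L2_set f ?I * L2_set g ?I"
    if f: "(\<Sum>p\<in>?I. f p) = 0" and g: "(\<Sum>p\<in>?I. g p) = 0" for f g
  proof -
    have "bilinear_sum ?I ?A f g = (\<Sum>p\<in>?I. f p / 2 * (\<Sum>q\<in>?I. g q) - f p * g p / 2)"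
      unfolding bilinear_sum_def
    proof (intro sum.cong refl)
      fix p assume p: "p \<in> ?I"
      have "(\<Sum>q\<in>?I. f p * ?A p q * g q) = (\<Sum>q\<in>?I. f p / 2 * g q - (if p = q then f p * g q / 2 else 0))"
        by (intro sum.cong) auto
      also have "\<dots> = f p / 2 * (\<Sum>q\<in>?I. g q) - f p * g p / 2"
        using p V by (simp add: sum_subtractf sum_distrib_left)
      finally show "(\<Sum>q\<in>?I. f p * ?A p q * g q) = f p / 2 * (\<Sum>q\<in>?I. g q) - f p * g p / 2" .
    qed
    also have "\<dots> = - (\<Sum>p\<in>?I. f p * g p) / 2"
      by (simp add: g sum_negf sum_divide_distrib)
    finally have "\<bar>bilinear_sum ?I ?A f g\<bar> = \<bar>\<Sum>p\<in>?I. f p * g p\<bar> / 2"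
      by simp
    also have "\<dots> \<le> (\<Sum>p\<in>?I. \<bar>f p\<bar> * \<bar>g p\<bar>) / 2"
      using sum_abs[of "\<lambda>p. f p * g p" ?I] by (simp add: abs_mult)
    also have "\<dots> \<le> L2_set f ?I * L2_set g ?I / 2"
      using L2_set_mult_ineq[of f g ?I] by simp
    finally show ?thesis by simp
  qed
  then show ?thesis
    unfolding derangement_kernel_def using eq row col by auto
qed

lemma sum_removed_edge:
  fixes h :: "('a \<Rightarrow> 'a) \<Rightarrow> real"
  assumes "x \<in> V" "y \<in> V" "x \<noteq> y"
  shows "(\<Sum>p | p \<in> fpf_invs V \<and> p x = y. h (p \<circ> transpose x y)) = (\<Sum>q\<in>fpf_invs (V - {x, y}). h q)"
  by (simp add: sum_fpf_invs_edge[OF assms] o_assoc[symmetric])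

lemma L2_set_removed_edge:
  assumes "x \<in> V" "y \<in> V" "x \<noteq> y"
  shows "L2_set (\<lambda>q. f (q \<circ> transpose x y)) (fpf_invs (V - {x, y})) = L2_set f {p \<in> fpf_invs V. p x = y}"
  by (simp add: L2_set_def sum_fpf_invs_edge[OF assms])

text \<open>Unfolding the recursion down to four vertices, this is the relation that \<open>p\<close> and \<open>q\<close> together
  form a Hamiltonian cycle: the path \<open>p v\<close>, \<open>v\<close>, \<open>q v\<close> of the cycle is contracted to a point.\<close>

definition lift_kernel :: "'a \<Rightarrow> ('a \<Rightarrow> ('a \<Rightarrow> 'a) \<Rightarrow> ('a \<Rightarrow> 'a) \<Rightarrow> real) \<Rightarrow> ('a \<Rightarrow> 'a) \<Rightarrow> ('a \<Rightarrow> 'a) \<Rightarrow> real" where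
  "lift_kernel v A p q = (if p v = q v then 0
    else A (p v) (p \<circ> transpose v (p v)) (swap_conj (q v) (p v) q \<circ> transpose v (p v)))"

section \<open>Lifting kernels from the blocks at \<open>v\<close> to all matchings of
  \<open>V\<close>\<close>

context
  fixes V :: "'a set" and v :: 'a and n :: nat and c :: real
    and A :: "'a \<Rightarrow> ('a \<Rightarrow> 'a) \<Rightarrow> ('a \<Rightarrow> 'a) \<Rightarrow> real"
  assumes V: "finite V" "card V = 2 * Suc (Suc n)" and v: "v \<in> V"
    and A: "\<And>u. u \<in> V - {v} \<Longrightarrow> derangement_kernel (V - {v, u}) c (A u)"
begin

lemma partner_mem: "p \<in> fpf_invs V \<Longrightarrow> p v \<in> V - {v}"
  using v by (auto simp: fpf_invs_mem_iff fpf_invs_fixed_iff)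

lemma card_minus_edge: "u \<in> V - {v} \<Longrightarrow> card (V - {v, u}) = 2 * Suc n"
  using V v by (subst card_Diff_subset) auto

lemma swap_removed_mem:
  assumes "q \<in> fpf_invs V" "u \<in> V - {v}"
  shows "swap_conj (q v) u q \<circ> transpose v u \<in> fpf_invs (V - {v, u})"
  using assms partner_mem[OF assms(1)] v
  by (intro remove_edge_mem swap_conj_mem swap_conj_partner) auto

text \<open>If \<open>p v\<close> and \<open>q v\<close> differ, a common edge avoids
  \<open>v\<close>, \<open>p v\<close> and \<open>q v\<close>. Switch and contraction leave it in
  place, so the arguments of \<open>A\<close> still share it.\<close>

lemma lift_kernel_disjoint:
  assumes p: "p \<in> fpf_invs V" and q: "q \<in> fpf_invs V" and x: "x \<in> V" "p x = q x"
  shows "lift_kernel v A p q = 0"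
proof (cases "p v = q v")
  case False
  let ?r = "swap_conj (q v) (p v) q"
  have inv: "p (p y) = y" "q (q y) = y" for y
    using p q by (auto simp: fpf_invs_invol)
  have x_ne: "x \<noteq> v" "x \<noteq> p v" "x \<noteq> q v"
    using False x inv by metis+
  have qx: "q x \<noteq> v" "q x \<noteq> p v" "q x \<noteq> q v"
    using x x_ne inv by metis+
  have "?r x = q x"
    using x_ne qx by (simp add: swap_conj_def)
  then have eq: "(p \<circ> transpose v (p v)) x = (?r \<circ> transpose v (p v)) x"
    using x x_ne by simp
  have "A (p v) (p \<circ> transpose v (p v)) (?r \<circ> transpose v (p v)) = 0"
    by (rule derangement_kernelD(1)[OF A[OF partner_mem[OF p]] remove_edge_mem[OF p refl]
          swap_removed_mem[OF q partner_mem[OF p]] _ eq]) (use x x_ne in auto)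
  then show ?thesis by (simp add: lift_kernel_def)
qed (simp add: lift_kernel_def)

text \<open>Substituting \<open>r = swap_conj (q v) (p v) q\<close> turns the sum over
  \<open>q\<close> into one over the block of \<open>p\<close> and the switches of \<open>r\<close>:
  the operator is the switch operator followed by a block diagonal one.\<close>

lemma sum_lift_kernel:
  assumes p: "p \<in> fpf_invs V"
  shows "(\<Sum>q\<in>fpf_invs V. lift_kernel v A p q * g q)
    = (\<Sum>r | r \<in> fpf_invs V \<and> r v = p v. A (p v) (p \<circ> transpose v (p v)) (r \<circ> transpose v (p v)) * switch_sum V v g r)"
proof -
  let ?u = "p v"
  let ?t = "transpose v ?u"
  have "(\<Sum>q\<in>fpf_invs V. lift_kernel v A p q * g q)
      = (\<Sum>q | q \<in> fpf_invs V \<and> q v \<noteq> ?u. A ?u (p \<circ> ?t) (swap_conj (q v) ?u q \<circ> ?t) * g q)"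
    by (rule sum.mono_neutral_cong_right) (use V in \<open>auto simp: lift_kernel_def\<close>)
  also have "\<dots> = (\<Sum>r | r \<in> fpf_invs V \<and> r v = ?u. \<Sum>w\<in>V - {v, ?u}. A ?u (p \<circ> ?t) (r \<circ> ?t) * g (swap_conj ?u w r))"
    using partner_mem[OF p] v
    by (intro sum_switch[OF V(1), of v ?u "\<lambda>q r. A ?u (p \<circ> ?t) (r \<circ> ?t) * g q"]) auto
  also have "\<dots> = (\<Sum>r | r \<in> fpf_invs V \<and> r v = ?u. A ?u (p \<circ> ?t) (r \<circ> ?t) * switch_sum V v g r)"
    by (intro sum.cong refl) (auto simp: switch_sum_def sum_distrib_left)
  finally show ?thesis .
qed

lemma lift_kernel_row:
  assumes p: "p \<in> fpf_invs V"
  shows "(\<Sum>q\<in>fpf_invs V. lift_kernel v A p q) = 2 * (real n + 1)"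
proof -
  have one: "switch_sum V v (\<lambda>_. 1) r = 2 * (real n + 1)" if "r \<in> fpf_invs V" for r
    using card_minus_edge[OF partner_mem[OF that]] by (simp add: switch_sum_def)
  have u: "v \<in> V" "p v \<in> V" "v \<noteq> p v"
    using v partner_mem[OF p] by auto
  have "(\<Sum>q\<in>fpf_invs V. lift_kernel v A p q) = (\<Sum>q\<in>fpf_invs V. lift_kernel v A p q * 1)"
    by simp
  also have "\<dots> = (\<Sum>r | r \<in> fpf_invs V \<and> r v = p v. A (p v) (p \<circ> transpose v (p v)) (r \<circ> transpose v (p v))) * (2 * (real n + 1))"
    unfolding sum_lift_kernel[OF p] sum_distrib_right by (intro sum.cong refl) (simp add: one)
  also have "(\<Sum>r | r \<in> fpf_invs V \<and> r v = p v. A (p v) (p \<circ> transpose v (p v)) (r \<circ> transpose v (p v))) = 1"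
    unfolding sum_removed_edge[OF u]
    by (rule derangement_kernelD(2)[OF A[OF partner_mem[OF p]] remove_edge_mem[OF p refl]])
  finally show ?thesis by simp
qed

text \<open>Within each block \<open>u\<close> other than \<open>q v\<close> the entries form a
  column of \<open>A u\<close> and add up to 1; there are \<open>2 * (n + 1)\<close> such
  blocks.\<close>

lemma lift_kernel_col:
  assumes q: "q \<in> fpf_invs V"
  shows "(\<Sum>p\<in>fpf_invs V. lift_kernel v A p q) = 2 * (real n + 1)"
proof -
  have "(\<Sum>p\<in>fpf_invs V. lift_kernel v A p q) = (\<Sum>u\<in>V - {v}. \<Sum>p | p \<in> fpf_invs V \<and> p v = u. lift_kernel v A p q)"
    by (rule sum_fpf_invs_partner[OF V(1) v])
  also have "\<dots> = (\<Sum>u\<in>V - {v}. if u = q v then 0 else 1)"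
  proof (intro sum.cong refl)
    fix u assume u: "u \<in> V - {v}"
    show "(\<Sum>p | p \<in> fpf_invs V \<and> p v = u. lift_kernel v A p q) = (if u = q v then 0 else 1)"
    proof (cases "u = q v")
      case False
      then have "(\<Sum>p | p \<in> fpf_invs V \<and> p v = u. lift_kernel v A p q)
          = (\<Sum>p | p \<in> fpf_invs V \<and> p v = u. A u (p \<circ> transpose v u) (swap_conj (q v) u q \<circ> transpose v u))"
        by (intro sum.cong refl) (auto simp: lift_kernel_def)
      also have "\<dots> = (\<Sum>p\<in>fpf_invs (V - {v, u}). A u p (swap_conj (q v) u q \<circ> transpose v u))"
        using u v by (intro sum_removed_edge) auto
      also have "\<dots> = 1"
        by (rule derangement_kernelD(3)[OF A[OF u] swap_removed_mem[OF q u]])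
      finally show ?thesis using False by simp
    qed (simp add: lift_kernel_def)
  qed
  also have "\<dots> = (\<Sum>u\<in>V - {v, q v}. 1)"
    by (rule sum.mono_neutral_cong_right) (use V in auto)
  finally show ?thesis
    using card_minus_edge[OF partner_mem[OF q]] by simp
qed

lemma bilinear_sum_lift_kernel:
  "bilinear_sum (fpf_invs V) (lift_kernel v A) f g
    = (\<Sum>u\<in>V - {v}. bilinear_sum (fpf_invs (V - {v, u})) (A u)
        (\<lambda>q. f (q \<circ> transpose v u)) (\<lambda>q. switch_sum V v g (q \<circ> transpose v u)))"
proof -
  have "bilinear_sum (fpf_invs V) (lift_kernel v A) f g
      = (\<Sum>p\<in>fpf_invs V. f p * (\<Sum>q\<in>fpf_invs V. lift_kernel v A p q * g q))"
    unfolding bilinear_sum_def by (simp add: sum_distrib_left mult.assoc)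
  also have "\<dots> = (\<Sum>u\<in>V - {v}. \<Sum>p | p \<in> fpf_invs V \<and> p v = u. f p * (\<Sum>q\<in>fpf_invs V. lift_kernel v A p q * g q))"
    by (rule sum_fpf_invs_partner[OF V(1) v])
  also have "\<dots> = (\<Sum>u\<in>V - {v}. bilinear_sum (fpf_invs (V - {v, u})) (A u)
        (\<lambda>q. f (q \<circ> transpose v u)) (\<lambda>q. switch_sum V v g (q \<circ> transpose v u)))"
  proof (intro sum.cong[OF refl])
    fix u assume "u \<in> V - {v}"
    then have u: "v \<in> V" "u \<in> V" "v \<noteq> u" using v by auto
    have "(\<Sum>p | p \<in> fpf_invs V \<and> p v = u. f p * (\<Sum>q\<in>fpf_invs V. lift_kernel v A p q * g q))
        = (\<Sum>p | p \<in> fpf_invs V \<and> p v = u. f p * (\<Sum>r | r \<in> fpf_invs V \<and> r v = u.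
            A u (p \<circ> transpose v u) (r \<circ> transpose v u) * switch_sum V v g r))"
      by (intro sum.cong refl) (auto simp: sum_lift_kernel)
    also have "\<dots> = bilinear_sum (fpf_invs (V - {v, u})) (A u)
        (\<lambda>q. f (q \<circ> transpose v u)) (\<lambda>q. switch_sum V v g (q \<circ> transpose v u))"
      by (simp add: bilinear_sum_def sum_fpf_invs_edge[OF u] o_assoc[symmetric] sum_distrib_left mult.assoc)
    finally show "(\<Sum>p | p \<in> fpf_invs V \<and> p v = u. f p * (\<Sum>q\<in>fpf_invs V. lift_kernel v A p q * g q)) = \<dots>" .
  qed
  finally show ?thesis .
qed

text \<open>All blocks have size \<open>double_fact (2 * n + 1)\<close>, so the subtracted term is
  the mean of \<open>f\<close> over the block.\<close>

lemma edge_sum_block_mean: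
  assumes "u \<in> V - {v}"
  shows "edge_sum V (\<lambda>p. f p - edge_sum V f v (p v) / real (double_fact (2 * n + 1))) v u = 0"
proof -
  let ?M = "double_fact (2 * n + 1)"
  have pos: "?M > 0"
    by (rule double_fact_pos)
  have "card {p \<in> fpf_invs V. p v = u} = ?M"
    using assms V v card_fpf_invs_edge[of v V u] card_fpf_invs_double_fact[OF _ card_minus_edge[OF assms]] by auto
  then have "(\<Sum>p | p \<in> fpf_invs V \<and> p v = u. edge_sum V f v (p v) / real ?M) = edge_sum V f v u"
    using pos by simp
  then show ?thesis
    unfolding edge_sum_def sum_subtractf by (simp add: edge_sum_def)
qed

lemma sum_zero_if_edge_sums_zero:
  assumes "\<And>u. u \<in> V - {v} \<Longrightarrow> edge_sum V f v u = 0"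
  shows "(\<Sum>p\<in>fpf_invs V. f p) = 0"
  using sum_edge_sum[OF V(1) v, of f] assms by simp

text \<open>The switches from a block reach each matching outside it exactly once, so the new block
  sum is the total minus the old one. Hence the norm bound of \<open>A u\<close> still applies after
  a switch.\<close>

lemma edge_sum_switch_sum_zero:
  assumes f: "\<And>u. u \<in> V - {v} \<Longrightarrow> edge_sum V f v u = 0" and u: "u \<in> V - {v}"
  shows "edge_sum V (switch_sum V v f) v u = 0"
proof -
  have "edge_sum V (switch_sum V v f) v u
      = (\<Sum>r | r \<in> fpf_invs V \<and> r v = u. \<Sum>w\<in>V - {v, u}. f (swap_conj u w r))"
    unfolding edge_sum_def by (intro sum.cong refl) (auto simp: switch_sum_def)
  also have "\<dots> = (\<Sum>q | q \<in> fpf_invs V \<and> q v \<noteq> u. f q)"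
    using sum_switch[OF V(1) v, of u "\<lambda>q r. f q"] u by auto
  also have "\<dots> = (\<Sum>q\<in>fpf_invs V. f q) - (\<Sum>q | q \<in> fpf_invs V \<and> q v = u. f q)"
    using sum.Int_Diff[of "fpf_invs V" f "{q. q v = u}"] V by (simp add: Int_def set_diff_eq)
  also have "\<dots> = 0"
    using sum_zero_if_edge_sums_zero[OF f] f[OF u] by (simp add: edge_sum_def)
  finally show ?thesis .
qed

lemma L2_set_partner:
  "L2_set (\<lambda>u. L2_set f {p \<in> fpf_invs V. p v = u}) (V - {v}) = L2_set f (fpf_invs V)"
  using sum_fpf_invs_partner[OF V(1) v, of "\<lambda>p. (f p)\<^sup>2"] by (simp add: L2_set_def sum_nonneg)

text \<open>Pythagoras: deviations from block means are orthogonal to functions constant on the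
  blocks.\<close>

lemma L2_set_block_mean:
  fixes f defines "a \<equiv> \<lambda>u. edge_sum V f v u / real (double_fact (2 * n + 1))"
  shows "(L2_set f (fpf_invs V))\<^sup>2
    = (L2_set (\<lambda>p. f p - a (p v)) (fpf_invs V))\<^sup>2 + (L2_set (\<lambda>p. a (p v)) (fpf_invs V))\<^sup>2"
proof -
  have "edge_sum V (\<lambda>p. f p - a (p v)) v u = 0" if "u \<in> V - {v}" for u
    using edge_sum_block_mean[OF that, of f] by (simp add: a_def)
  then have cross: "(\<Sum>p\<in>fpf_invs V. a (p v) * (f p - a (p v))) = 0"
    unfolding sum_partner_weight[OF V(1) v, of a "\<lambda>p. f p - a (p v)"] by simp
  have "(\<Sum>p\<in>fpf_invs V. (f p)\<^sup>2)
      = (\<Sum>p\<in>fpf_invs V. (f p - a (p v))\<^sup>2) + (\<Sum>p\<in>fpf_invs V. (a (p v))\<^sup>2) + 2 * (\<Sum>p\<in>fpf_invs V. a (p v) * (f p - a (p v)))"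
    unfolding sum_distrib_left sum.distrib[symmetric]
    by (intro sum.cong refl) (simp add: power2_eq_square algebra_simps)
  then show ?thesis
    unfolding cross by (simp add: L2_set_def sum_nonneg)
qed

lemma switch_sum_partner_weight:
  assumes b: "(\<Sum>u\<in>V - {v}. b u) = 0" and r: "r \<in> fpf_invs V"
  shows "switch_sum V v (\<lambda>p. b (p v)) r = - b (r v)"
proof -
  have "switch_sum V v (\<lambda>p. b (p v)) r = (\<Sum>w\<in>V - {v} - {r v}. b w)"
    unfolding switch_sum_def using r v by (intro sum.cong) (auto simp: swap_conj_partner)
  also have "\<dots> = (\<Sum>w\<in>V - {v}. b w) - b (r v)"
    using V partner_mem[OF r] by (subst sum_diff1) auto
  finally show ?thesis using b by simp
qed

text \<open>Split \<open>f\<close> and \<open>g\<close> into block means \<open>a\<close>,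
  \<open>b\<close> and remainders \<open>f1\<close>, \<open>g1\<close>. The switch operator negates
  \<open>b\<close> and enlarges \<open>g1\<close> by at most \<open>2 * n\<close>, which the factor
  \<open>c\<close> from the blocks cancels; so neither part is amplified.\<close>

lemma lift_kernel_bound:
  assumes n: "n \<ge> 1" and c: "c = 1 / (2 * real n)"
    and f: "(\<Sum>p\<in>fpf_invs V. f p) = 0" and g: "(\<Sum>p\<in>fpf_invs V. g p) = 0"
  shows "\<bar>bilinear_sum (fpf_invs V) (lift_kernel v A) f g\<bar> \<le> L2_set f (fpf_invs V) * L2_set g (fpf_invs V)"
proof -
  let ?I = "fpf_invs V"
  let ?B = "\<lambda>u. {p \<in> fpf_invs V. p v = u}"
  define M where "M = real (double_fact (2 * n + 1))"
  define a where "a = (\<lambda>u. edge_sum V f v u / M)"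
  define b where "b = (\<lambda>u. edge_sum V g v u / M)"
  define f1 where "f1 = (\<lambda>p. f p - a (p v))"
  define g1 where "g1 = (\<lambda>p. g p - b (p v))"
  define h where "h = switch_sum V v g1"
  have f1: "edge_sum V f1 v u = 0" and g1: "edge_sum V g1 v u = 0" if "u \<in> V - {v}" for u
    using edge_sum_block_mean[OF that, of f] edge_sum_block_mean[OF that, of g]
    by (simp_all add: f1_def g1_def a_def b_def M_def)
  have h: "edge_sum V h v u = 0" if "u \<in> V - {v}" for u
    unfolding h_def by (rule edge_sum_switch_sum_zero[OF g1 that])
  have b0: "(\<Sum>u\<in>V - {v}. b u) = 0"
    unfolding b_def sum_divide_distrib[symmetric] sum_edge_sum[OF V(1) v] g by simp
  have Tg: "switch_sum V v g r = h r + - b (r v)" if "r \<in> ?I" for r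
  proof -
    have "switch_sum V v g r = switch_sum V v (\<lambda>p. g1 p + 1 * b (p v)) r"
      by (simp add: g1_def)
    then show ?thesis
      unfolding switch_sum_add_scaled switch_sum_partner_weight[OF b0 that] by (simp add: h_def)
  qed
  have M: "real (card (?B u)) = M" if "u \<in> V - {v}" for u
    using that V v card_fpf_invs_edge[of v V u] card_fpf_invs_double_fact[OF _ card_minus_edge[OF that]]
    by (auto simp: M_def)
  have block: "\<bar>bilinear_sum (fpf_invs (V - {v, u})) (A u) (\<lambda>q. f (q \<circ> transpose v u)) (\<lambda>q. switch_sum V v g (q \<circ> transpose v u))
      + M * a u * b u\<bar> \<le> c * (L2_set f1 (?B u) * L2_set h (?B u))" if u: "u \<in> V - {v}" for u
  proof -
    have e: "v \<in> V" "u \<in> V" "v \<noteq> u" using u v by auto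
    have "bilinear_sum (fpf_invs (V - {v, u})) (A u) (\<lambda>q. f (q \<circ> transpose v u)) (\<lambda>q. switch_sum V v g (q \<circ> transpose v u))
        = bilinear_sum (fpf_invs (V - {v, u})) (A u) (\<lambda>q. f1 (q \<circ> transpose v u) + a u) (\<lambda>q. h (q \<circ> transpose v u) + - b u)"
      unfolding bilinear_sum_def
    proof (intro sum.cong refl)
      fix p q assume pq: "p \<in> fpf_invs (V - {v, u})" "q \<in> fpf_invs (V - {v, u})"
      note add = add_edge_mem[OF _ e]
      have "f (p \<circ> transpose v u) = f1 (p \<circ> transpose v u) + a u"
        using add(2)[OF pq(1)] unfolding f1_def by simp
      moreover have "switch_sum V v g (q \<circ> transpose v u) = h (q \<circ> transpose v u) + - b u"
        using Tg[OF add(1)[OF pq(2)]] unfolding add(2)[OF pq(2)] .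
      ultimately show "f (p \<circ> transpose v u) * A u p q * switch_sum V v g (q \<circ> transpose v u)
          = (f1 (p \<circ> transpose v u) + a u) * A u p q * (h (q \<circ> transpose v u) + - b u)"
        by (simp only:)
    qed
    also have "\<dots> = bilinear_sum (fpf_invs (V - {v, u})) (A u) (\<lambda>q. f1 (q \<circ> transpose v u)) (\<lambda>q. h (q \<circ> transpose v u))
        + real (card (fpf_invs (V - {v, u}))) * a u * (- b u)"
      using V(1) derangement_kernelD(2,3)[OF A[OF u]] f1[OF u] h[OF u]
      by (intro bilinear_sum_shift) (auto simp: sum_fpf_invs_edge[OF e, symmetric] edge_sum_def)
    also have "real (card (fpf_invs (V - {v, u}))) = M"
      using M[OF u] card_fpf_invs_edge[OF e] by simp
    finally have "bilinear_sum (fpf_invs (V - {v, u})) (A u) (\<lambda>q. f (q \<circ> transpose v u)) (\<lambda>q. switch_sum V v g (q \<circ> transpose v u))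
        + M * a u * b u = bilinear_sum (fpf_invs (V - {v, u})) (A u) (\<lambda>q. f1 (q \<circ> transpose v u)) (\<lambda>q. h (q \<circ> transpose v u))"
      by linarith
    moreover have "\<bar>bilinear_sum (fpf_invs (V - {v, u})) (A u) (\<lambda>q. f1 (q \<circ> transpose v u)) (\<lambda>q. h (q \<circ> transpose v u))\<bar>
        \<le> c * L2_set (\<lambda>q. f1 (q \<circ> transpose v u)) (fpf_invs (V - {v, u})) * L2_set (\<lambda>q. h (q \<circ> transpose v u)) (fpf_invs (V - {v, u}))"
      using f1[OF u] h[OF u] by (intro derangement_kernelD(4)[OF A[OF u]]) (auto simp: sum_fpf_invs_edge[OF e, symmetric] edge_sum_def)
    ultimately show ?thesis
      by (simp add: L2_set_removed_edge[OF e] mult.assoc)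
  qed
  have c0: "c \<ge> 0" using c by simp
  have norm_h: "L2_set h ?I \<le> 2 * real n * L2_set g1 ?I"
  proof (rule power2_le_imp_le)
    show "(L2_set h ?I)\<^sup>2 \<le> (2 * real n * L2_set g1 ?I)\<^sup>2"
      using switch_sum_contraction[OF V v n sum_zero_if_edge_sums_zero[OF g1]]
      by (simp add: L2_set_def h_def power_mult_distrib sum_nonneg)
  qed simp
  have mean: "\<bar>\<Sum>u\<in>V - {v}. M * a u * b u\<bar> \<le> L2_set (\<lambda>p. a (p v)) ?I * L2_set (\<lambda>p. b (p v)) ?I"
  proof -
    have "(\<Sum>p\<in>?I. a (p v) * b (p v)) = (\<Sum>u\<in>V - {v}. \<Sum>p\<in>?B u. a (p v) * b (p v))"
      by (rule sum_fpf_invs_partner[OF V(1) v])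
    also have "\<dots> = (\<Sum>u\<in>V - {v}. M * a u * b u)"
      by (intro sum.cong refl) (simp add: M)
    finally have "\<bar>\<Sum>u\<in>V - {v}. M * a u * b u\<bar> = \<bar>\<Sum>p\<in>?I. a (p v) * b (p v)\<bar>" by simp
    also have "\<dots> \<le> (\<Sum>p\<in>?I. \<bar>a (p v)\<bar> * \<bar>b (p v)\<bar>)"
      using sum_abs[of "\<lambda>p. a (p v) * b (p v)" ?I] by (simp add: abs_mult)
    also have "\<dots> \<le> L2_set (\<lambda>p. a (p v)) ?I * L2_set (\<lambda>p. b (p v)) ?I"
      by (rule L2_set_mult_ineq)
    finally show ?thesis .
  qed
  \<comment> \<open>Adding \<open>M * a u * b u\<close> removes the contribution of the means and
    isolates the pairing of \<open>f1\<close> with \<open>h\<close> on each block.\<close>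
  let ?S = "\<Sum>u\<in>V - {v}. bilinear_sum (fpf_invs (V - {v, u})) (A u) (\<lambda>q. f (q \<circ> transpose v u)) (\<lambda>q. switch_sum V v g (q \<circ> transpose v u)) + M * a u * b u"
  have "\<bar>?S\<bar> \<le> (\<Sum>u\<in>V - {v}. c * (L2_set f1 (?B u) * L2_set h (?B u)))"
    by (rule order_trans[OF sum_abs sum_mono[OF block]])
  also have "\<dots> = c * (\<Sum>u\<in>V - {v}. \<bar>L2_set f1 (?B u)\<bar> * \<bar>L2_set h (?B u)\<bar>)"
    by (simp add: sum_distrib_left)
  also have "\<dots> \<le> c * (L2_set f1 ?I * L2_set h ?I)"
    using L2_set_mult_ineq[of "\<lambda>u. L2_set f1 (?B u)" "\<lambda>u. L2_set h (?B u)" "V - {v}"] c0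
    unfolding L2_set_partner by (rule mult_left_mono)
  also have "\<dots> \<le> c * (L2_set f1 ?I * (2 * real n * L2_set g1 ?I))"
    by (intro mult_left_mono norm_h c0) simp
  also have "\<dots> = L2_set f1 ?I * L2_set g1 ?I"
    using n by (simp add: c)
  finally have S: "\<bar>?S\<bar> \<le> L2_set f1 ?I * L2_set g1 ?I" .
  have "bilinear_sum ?I (lift_kernel v A) f g = ?S - (\<Sum>u\<in>V - {v}. M * a u * b u)"
    by (simp add: bilinear_sum_lift_kernel sum.distrib)
  then have "\<bar>bilinear_sum ?I (lift_kernel v A) f g\<bar>
      \<le> L2_set f1 ?I * L2_set g1 ?I + L2_set (\<lambda>p. a (p v)) ?I * L2_set (\<lambda>p. b (p v)) ?I"
    using S mean by linarith
  also have "\<dots> \<le> L2_set f ?I * L2_set g ?I"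
  proof (rule power2_le_imp_le)
    \<comment> \<open>Two-dimensional Cauchy-Schwarz, to be combined with the Pythagorean splitting
      of both norms.\<close>
    have "(x * y + z * w)\<^sup>2 \<le> (x\<^sup>2 + z\<^sup>2) * (y\<^sup>2 + w\<^sup>2)" for x y z w :: real
    proof -
      have "(x\<^sup>2 + z\<^sup>2) * (y\<^sup>2 + w\<^sup>2) - (x * y + z * w)\<^sup>2 = (x * w - z * y)\<^sup>2"
        by (simp add: power2_eq_square algebra_simps)
      then show ?thesis using zero_le_power2[of "x * w - z * y"] by linarith
    qed
    then show "(L2_set f1 ?I * L2_set g1 ?I + L2_set (\<lambda>p. a (p v)) ?I * L2_set (\<lambda>p. b (p v)) ?I)\<^sup>2
        \<le> (L2_set f ?I * L2_set g ?I)\<^sup>2"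
      unfolding power_mult_distrib L2_set_block_mean[of f] L2_set_block_mean[of g]
      by (simp add: f1_def g1_def a_def b_def M_def)
  qed simp
  finally show ?thesis .
qed

end

text \<open>In the step, deleting \<open>v\<close> with each possible partner gives smaller kernels
  to lift. Dividing by the row sum \<open>?m\<close> restores unit row and column sums and turns the
  norm bound 1 into \<open>1 / ?m\<close>.\<close>

lemma derangement_kernel_exists:
  assumes "finite V" "card V = 2 * Suc (Suc n)"
  shows "\<exists>A. derangement_kernel V (1 / (2 * (real n + 1))) A"
  using assms
proof (induction n arbitrary: V)
  case 0
  then show ?case using derangement_kernel_card4[of V] by auto
next
  case (Suc k)
  note V = Suc.prems
  obtain v where v: "v \<in> V" using V by fastforce
  have "\<exists>A. derangement_kernel (V - {v, u}) (1 / (2 * (real k + 1))) A" if u: "u \<in> V - {v}" for u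
  proof (rule Suc.IH)
    show "card (V - {v, u}) = 2 * Suc (Suc k)"
      using V v u by (subst card_Diff_subset) auto
  qed (use V in simp)
  then obtain A where A: "\<And>u. u \<in> V - {v} \<Longrightarrow> derangement_kernel (V - {v, u}) (1 / (2 * (real k + 1))) (A u)"
    by metis
  let ?m = "2 * (real (Suc k) + 1)"
  have scale: "bilinear_sum S (\<lambda>p q. L p q / ?m) f g = bilinear_sum S L f g / ?m" for S L and f g :: "('a \<Rightarrow> 'a) \<Rightarrow> real"
    by (simp add: bilinear_sum_def sum_divide_distrib)
  have "derangement_kernel V (1 / ?m) (\<lambda>p q. lift_kernel v A p q / ?m)"
    unfolding derangement_kernel_def
  proof (intro conjI ballI impI allI)
    fix p q assume "p \<in> fpf_invs V" "q \<in> fpf_invs V" "\<exists>x\<in>V. p x = q x"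
    then show "lift_kernel v A p q / ?m = 0"
      using lift_kernel_disjoint[OF V v A] by auto
  next
    fix p assume "p \<in> fpf_invs V"
    then show "(\<Sum>q\<in>fpf_invs V. lift_kernel v A p q / ?m) = 1"
      using lift_kernel_row[OF V v A, of p] by (simp add: sum_divide_distrib[symmetric])
  next
    fix q assume "q \<in> fpf_invs V"
    then show "(\<Sum>p\<in>fpf_invs V. lift_kernel v A p q / ?m) = 1"
      using lift_kernel_col[OF V v A, of q] by (simp add: sum_divide_distrib[symmetric])
  next
    fix f g :: "('a \<Rightarrow> 'a) \<Rightarrow> real"
    assume "sum f (fpf_invs V) = 0" "sum g (fpf_invs V) = 0"
    then have "\<bar>bilinear_sum (fpf_invs V) (lift_kernel v A) f g\<bar> \<le> L2_set f (fpf_invs V) * L2_set g (fpf_invs V)"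
      by (intro lift_kernel_bound[OF V v A]) auto
    then show "\<bar>bilinear_sum (fpf_invs V) (\<lambda>p q. lift_kernel v A p q / ?m) f g\<bar>
        \<le> 1 / ?m * L2_set f (fpf_invs V) * L2_set g (fpf_invs V)"
      unfolding scale by (simp add: divide_right_mono)
  qed
  then show ?case by blast
qed

section \<open>Cross-intersecting families\<close>

text \<open>The form vanishes on the two indicators, so the mean part \<open>N * a * b\<close> is at
  most the size of the centred part. As \<open>N = (K + 1) * double_fact (2 * n + 1)\<close>, the
  goal is \<open>(K + 1)\<^sup>2 * (a * b) \<le> 1\<close> for the densities \<open>a\<close> and
  \<open>b\<close>.\<close>

lemma agreeing_families_card_bound:
  assumes V: "finite V" "card V = 2 * Suc (Suc n)"
    and XY: "X \<subseteq> fpf_invs V" "Y \<subseteq> fpf_invs V"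
    and agree: "\<And>p q. p \<in> X \<Longrightarrow> q \<in> Y \<Longrightarrow> \<exists>x\<in>V. p x = q x"
  shows "card X * card Y \<le> (double_fact (2 * n + 1))\<^sup>2"
proof -
  let ?I = "fpf_invs V"
  define K where "K = 2 * (real n + 1)"
  obtain A where A: "derangement_kernel V (1 / K) A"
    using derangement_kernel_exists[OF V] unfolding K_def by blast
  define N where "N = real (card ?I)"
  define a where "a = real (card X) / N"
  define b where "b = real (card Y) / N"
  have K: "K > 0" by (simp add: K_def)
  have N: "N = (K + 1) * real (double_fact (2 * n + 1))"
    using card_fpf_invs_double_fact[OF V] by (simp add: N_def K_def algebra_simps)
  then have N0: "N > 0" using K double_fact_pos[of "2 * n + 1"] by simp
  have fin: "finite ?I" using V by simp
  have ab: "0 \<le> a" "a \<le> 1" "0 \<le> b" "b \<le> 1"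
    using N0 card_mono[OF fin XY(1)] card_mono[OF fin XY(2)] by (auto simp: a_def b_def N_def)
  have sum_ind: "(\<Sum>p\<in>?I. of_bool (p \<in> Z)) = real (card Z)" if "Z \<subseteq> ?I" for Z
    using fin that by (simp add: Int_absorb1)
  have centered: "(\<Sum>p\<in>?I. of_bool (p \<in> Z) - real (card Z) / N) = 0" if "Z \<subseteq> ?I" for Z
    using N0 by (simp add: sum_subtractf sum_ind[OF that] N_def)
  have norm: "(L2_set (\<lambda>p. of_bool (p \<in> Z) - d) ?I)\<^sup>2 = N * (d * (1 - d))"
    if Z: "Z \<subseteq> ?I" and d: "d = real (card Z) / N" for Z and d :: real
  proof -
    have "(L2_set (\<lambda>p. of_bool (p \<in> Z) - d) ?I)\<^sup>2 = (\<Sum>p\<in>?I. (of_bool (p \<in> Z) - d)\<^sup>2)"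
      by (simp add: L2_set_def sum_nonneg)
    also have "\<dots> = (\<Sum>p\<in>?I. (1 - 2 * d) * of_bool (p \<in> Z) + d\<^sup>2)"
      by (intro sum.cong refl) (simp add: of_bool_def power2_eq_square algebra_simps)
    also have "\<dots> = (1 - 2 * d) * real (card Z) + N * d\<^sup>2"
      by (simp add: sum.distrib sum_distrib_left[symmetric] sum_ind[OF Z] N_def)
    also have "real (card Z) = N * d"
      using N0 by (simp add: d)
    finally show ?thesis by (simp add: power2_eq_square algebra_simps)
  qed
  have "bilinear_sum ?I A (\<lambda>p. of_bool (p \<in> X) - a + a) (\<lambda>q. of_bool (q \<in> Y) - b + b) = 0"
    unfolding bilinear_sum_def
  proof (intro sum.neutral ballI)
    fix p q assume "p \<in> ?I" "q \<in> ?I"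
    then have "p \<in> X \<Longrightarrow> q \<in> Y \<Longrightarrow> A p q = 0"
      using agree derangement_kernelD(1)[OF A] by blast
    then show "(of_bool (p \<in> X) - a + a) * A p q * (of_bool (q \<in> Y) - b + b) = 0"
      by auto
  qed
  moreover have "bilinear_sum ?I A (\<lambda>p. of_bool (p \<in> X) - a + a) (\<lambda>q. of_bool (q \<in> Y) - b + b)
      = bilinear_sum ?I A (\<lambda>p. of_bool (p \<in> X) - a) (\<lambda>q. of_bool (q \<in> Y) - b) + N * a * b"
    unfolding N_def using centered[OF XY(1)] centered[OF XY(2)]
    by (intro bilinear_sum_shift fin derangement_kernelD(2,3)[OF A]) (auto simp: a_def b_def)
  moreover have "\<bar>bilinear_sum ?I A (\<lambda>p. of_bool (p \<in> X) - a) (\<lambda>q. of_bool (q \<in> Y) - b)\<bar>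
      \<le> 1 / K * L2_set (\<lambda>p. of_bool (p \<in> X) - a) ?I * L2_set (\<lambda>q. of_bool (q \<in> Y) - b) ?I"
    unfolding a_def b_def by (rule derangement_kernelD(4)[OF A centered[OF XY(1)] centered[OF XY(2)]])
  ultimately have "N * (a * b) \<le> 1 / K * L2_set (\<lambda>p. of_bool (p \<in> X) - a) ?I * L2_set (\<lambda>q. of_bool (q \<in> Y) - b) ?I"
    by linarith
  then have "K * N * (a * b) \<le> L2_set (\<lambda>p. of_bool (p \<in> X) - a) ?I * L2_set (\<lambda>q. of_bool (q \<in> Y) - b) ?I"
    using K by (simp add: field_simps)
  then have "(K * N * (a * b))\<^sup>2 \<le> (L2_set (\<lambda>p. of_bool (p \<in> X) - a) ?I * L2_set (\<lambda>q. of_bool (q \<in> Y) - b) ?I)\<^sup>2"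
    using ab K N0 by (intro power_mono) auto
  also have "\<dots> = (N * (a * (1 - a))) * (N * (b * (1 - b)))"
    unfolding power_mult_distrib norm[OF XY(1) a_def] norm[OF XY(2) b_def] ..
  finally have "N\<^sup>2 * ((a * b) * (K\<^sup>2 * (a * b))) \<le> N\<^sup>2 * ((a * b) * ((1 - a) * (1 - b)))"
    by (simp add: power2_eq_square algebra_simps)
  then have main: "(a * b) * (K\<^sup>2 * (a * b)) \<le> (a * b) * ((1 - a) * (1 - b))"
    using N0 by (simp add: mult_le_cancel_left_pos)
  have "(K + 1)\<^sup>2 * (a * b) \<le> 1"
  proof (cases "a * b = 0")
    case False
    \<comment> \<open>For the geometric mean \<open>s\<close>, the inequality of means gives
      \<open>(1 - a) * (1 - b) \<le> (1 - s)\<^sup>2\<close>, which reduces the claim to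
      \<open>K * s \<le> 1 - s\<close>.\<close>
    define s where "s = sqrt (a * b)"
    have s: "s \<ge> 0" "s\<^sup>2 = a * b" "s > 0" using ab False by (auto simp: s_def less_le)
    have "K\<^sup>2 * (a * b) \<le> (1 - a) * (1 - b)"
      using main s by (metis mult_le_cancel_left_pos zero_less_power)
    moreover have "(1 - a) * (1 - b) \<le> (1 - s)\<^sup>2"
      using arith_geo_mean_sqrt[of a b] ab s by (simp add: s_def power2_eq_square algebra_simps)
    ultimately have "(K * s)\<^sup>2 \<le> (1 - s)\<^sup>2"
      by (simp add: power_mult_distrib s)
    moreover have "s \<le> 1"
      using ab by (auto simp: s_def intro: mult_le_one)
    ultimately have "K * s \<le> 1 - s"
      by (intro power2_le_imp_le[of "K * s"]) auto
    then have "((K + 1) * s)\<^sup>2 \<le> 1"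
      using K s by (intro power_le_one) (auto simp: algebra_simps)
    then show ?thesis by (simp add: power_mult_distrib s)
  qed auto
  moreover have "real (card X) = N * a" "real (card Y) = N * b"
    using N0 by (simp_all add: a_def b_def)
  ultimately have "real (card X) * real (card Y) \<le> (real (double_fact (2 * n + 1)))\<^sup>2"
    using mult_left_mono[of "(K + 1)\<^sup>2 * (a * b)" 1 "(real (double_fact (2 * n + 1)))\<^sup>2"]
    by (simp add: N power2_eq_square algebra_simps)
  then show ?thesis
    by (metis of_nat_le_iff of_nat_mult of_nat_power)
qed

section \<open>Translating perfect matchings into involutions\<close>

definition partner_fun :: "'a set \<Rightarrow> 'a set set \<Rightarrow> 'a \<Rightarrow> 'a" where
  "partner_fun V m x = (if x \<in> V then (THE y. {x, y} \<in> m) else x)"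

lemma partner_fun_iff:
  assumes m: "perfect_matching V (nsets V 2) m" and x: "x \<in> V"
  shows "{x, y} \<in> m \<longleftrightarrow> partner_fun V m x = y"
proof -
  obtain e where e: "e \<in> m" "x \<in> e" and uniq: "\<And>e'. e' \<in> m \<Longrightarrow> x \<in> e' \<Longrightarrow> e' = e"
    using m x unfolding perfect_matching_def by metis
  obtain z where z: "e = {x, z}" "z \<noteq> x"
    using m e unfolding perfect_matching_def by (auto elim!: nsets2_E dest!: subsetD)
  have iff: "{x, y} \<in> m \<longleftrightarrow> y = z" for y
    using uniq[of "{x, y}"] e z by (auto simp: doubleton_eq_iff)
  then show ?thesis using x by (auto simp: partner_fun_def)
qed

lemma partner_fun_mem:
  assumes m: "perfect_matching V (nsets V 2) m"
  shows "partner_fun V m \<in> fpf_invs V"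
proof -
  have edge: "partner_fun V m x \<in> V \<and> partner_fun V m x \<noteq> x \<and> partner_fun V m (partner_fun V m x) = x"
    if x: "x \<in> V" for x
  proof -
    have e: "{x, partner_fun V m x} \<in> m"
      using partner_fun_iff[OF m x] by simp
    then have "{x, partner_fun V m x} \<in> nsets V 2"
      using m unfolding perfect_matching_def by blast
    then have "partner_fun V m x \<in> V" "partner_fun V m x \<noteq> x"
      by (auto simp: doubleton_in_nsets_2)
    with e show ?thesis
      using partner_fun_iff[OF m, of "partner_fun V m x" x] by (simp add: insert_commute)
  qed
  have outside: "partner_fun V m x = x" if "x \<notin> V" for x
    using that by (simp add: partner_fun_def)
  have "partner_fun V m (partner_fun V m x) = x \<and> (partner_fun V m x = x \<longleftrightarrow> x \<notin> V)" for x
    using edge[of x] outside[of x] by (cases "x \<in> V") simp_all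
  then show ?thesis
    by (simp add: fpf_invs_def)
qed

text \<open>Recovering \<open>m\<close> from its involution makes the encoding injective and turns a
  common edge into a vertex of agreement.\<close>

lemma perfect_matching_edges:
  assumes m: "perfect_matching V (nsets V 2) m"
  shows "m = (\<lambda>x. {x, partner_fun V m x}) ` V"
proof -
  have "\<exists>x\<in>V. e = {x, partner_fun V m x}" if e: "e \<in> m" for e
  proof -
    obtain x y where "e = {x, y}" "x \<in> V"
      using m e unfolding perfect_matching_def by (auto elim!: nsets2_E dest!: subsetD)
    then show ?thesis using partner_fun_iff[OF m, of x y] e by auto
  qed
  then show ?thesis using partner_fun_iff[OF m] by auto
qed

lemma partner_fun_inject:
  assumes "perfect_matching V (nsets V 2) m" "perfect_matching V (nsets V 2) m'"
    and eq: "partner_fun V m = partner_fun V m'"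
  shows "m = m'"
proof -
  have "m = (\<lambda>x. {x, partner_fun V m x}) ` V"
    by (rule perfect_matching_edges[OF assms(1)])
  also have "\<dots> = (\<lambda>x. {x, partner_fun V m' x}) ` V"
    by (simp only: eq)
  also have "\<dots> = m'"
    by (rule perfect_matching_edges[OF assms(2), symmetric])
  finally show ?thesis .
qed

theorem theorem3p11:
  fixes n :: nat and F G :: "nat set set set"
  assumes "F \<subseteq> perfect_matchings_K (2 * n)"
    and "G \<subseteq> perfect_matchings_K (2 * n)"
    and "cross_intersecting F G"
  shows "card F * card G \<le> (double_fact (2 * n - 3))\<^sup>2"
proof -
  let ?V = "{1..2 * n}"
  let ?p = "partner_fun ?V"
  have F: "perfect_matching ?V (nsets ?V 2) m" if "m \<in> F" for m
    using assms(1) that by (auto simp: perfect_matchings_K_def)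
  have G: "perfect_matching ?V (nsets ?V 2) m" if "m \<in> G" for m
    using assms(2) that by (auto simp: perfect_matchings_K_def)
  have inj: "inj_on ?p F" "inj_on ?p G"
    by (rule inj_onI, rule partner_fun_inject[OF F F]; assumption)
      (rule inj_onI, rule partner_fun_inject[OF G G]; assumption)
  have card: "card F = card (?p ` F)" "card G = card (?p ` G)"
    by (simp_all only: card_image[OF inj(1)] card_image[OF inj(2)])
  have sub: "?p ` F \<subseteq> fpf_invs ?V" "?p ` G \<subseteq> fpf_invs ?V"
    using partner_fun_mem[OF F] partner_fun_mem[OF G] by auto
  have agree: "\<exists>x\<in>?V. ?p m x = ?p m' x" if mm': "m \<in> F" "m' \<in> G" for m m'
  proof -
    obtain e where e: "e \<in> m" "e \<in> m'"
      using assms(3) mm' by (auto simp: cross_intersecting_def)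
    obtain x where x: "x \<in> ?V" "e = {x, ?p m x}"
      using e(1) perfect_matching_edges[OF F[OF mm'(1)]] by blast
    then show ?thesis
      using e(2) partner_fun_iff[OF G[OF mm'(2)] x(1)] by metis
  qed
  consider "n = 0" | "n = 1" | k where "n = Suc (Suc k)"
    by (metis One_nat_def not0_implies_Suc)
  then show ?thesis
  proof cases
    case 1
    \<comment> \<open>There is no vertex to agree at.\<close>
    then have "F = {} \<or> G = {}" using agree by auto
    then show ?thesis by auto
  next
    case 2
    \<comment> \<open>Two vertices have a single perfect matching, and \<open>2 * n - 3\<close>
      truncates to \<open>0\<close>, so the bound is 1.\<close>
    have "card (fpf_invs ?V) = 1"
      using card_fpf_invs_double_fact[of ?V n] by (simp add: 2)
    then have "card F \<le> 1" "card G \<le> 1"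
      unfolding card using sub card_mono[OF finite_fpf_invs, of ?V] by (metis finite_atLeastAtMost)+
    then show ?thesis
      using mult_le_mono[of "card F" 1 "card G" 1] by (simp add: 2)
  next
    case (3 k)
    \<comment> \<open>Here \<open>n = k + 2\<close>, so \<open>2 * k + 1\<close> is
      \<open>2 * n - 3\<close>.\<close>
    have "card (?p ` F) * card (?p ` G) \<le> (double_fact (2 * k + 1))\<^sup>2"
      using sub agree by (intro agreeing_families_card_bound[of ?V]) (auto simp: 3)
    then show ?thesis
      unfolding card by (simp add: 3)
  qed
qed

end
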